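(* Let $\varphi_1,\varphi_2$ satisfy the standing assumptions in the context, with moduli $L>0$ and $\sigma\in[-L,L]$ for $\varphi_1$, and put $\varphi=\varphi_1+\varphi_2$ and $p_1=\sigma/L$. Let $\gamma>0$ and $\lambda>0$ be such that one of the following holds: (A) $\lambda\in(0,2)$ and $\gamma<\min\{\frac{2-\lambda}{2[\sigma]_-},\frac1L\}$; or (B) $\sigma>0$, $2\le\lambda<\frac{4}{1+\sqrt{1-p_1}}$ and $\frac{p_1\lambda-\delta}{4\sigma}<\gamma<\frac{p_1\lambda+\delta}{4\sigma}$, where $\delta=\sqrt{(p_1\lambda)^2-8p_1(\lambda-2)}$. Let $(s^k,u^k,v^k)_{k\in\mathbb N}$ be generated by Douglas-Rachford splitting (DRS) with stepsize $\gamma$ and relaxation $\lambda$ starting from $s^0\in\mathbb R^p$. Then: (i) The residual $(u^k-v^k)_k$ vanishes with rate $\min_{i\le k}\|u^i-v^i\|=o(1/\sqrt k)$. (ii) $(u^k)_k$ and $(v^k)_k$ have the same cluster points, all of which are stationary for $\varphi$ and on which $\varphi$ has the same value, this being the limit of $(\varphi_\gamma^{\rm dr}(s^k))_k$. In fact, for each $k$ one has $\operatorname{dist}(0,\hat\partial\varphi(v^k))\le\frac{1-\gamma\sigma}{\gamma}\|u^k-v^k\|$. (iii) If $\varphi$ has bounded level sets, then the sequence $(s^k,u^k,v^k)_k$ is bounded.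
   Context: Standing assumptions: $\varphi_1:\mathbb R^p\to\mathbb R$ is $L$-smooth (differentiable with $L$-Lipschitz gradient) and $\sigma$-hypoconvex, meaning $\varphi_1-\frac{\sigma}{2}\|\cdot\|^2$ is convex; $\varphi_2:\mathbb R^p\to\mathbb R\cup\{\infty\}$ is proper and lower semicontinuous; $\operatorname{argmin}(\varphi_1+\varphi_2)\ne\emptyset$. Notation: $[r]_-=\max\{0,-r\}$, with $r/0=\infty$ for $r>0$. $\operatorname{prox}_{\gamma h}(x)=\operatorname{argmin}_w\{h(w)+\frac1{2\gamma}\|w-x\|^2\}$ (possibly set-valued). DRS iterates, for $k\ge0$: $u^k\in\operatorname{prox}_{\gamma\varphi_1}(s^k)$, $v^k\in\operatorname{prox}_{\gamma\varphi_2}(2u^k-s^k)$, $s^{k+1}=s^k+\lambda(v^k-u^k)$ (well defined for $\gamma<1/L$, with $\operatorname{prox}_{\gamma\varphi_1}$ single valued). Douglas-Rachford envelope (for $\gamma<1/L$): with $u=\operatorname{prox}_{\gamma\varphi_1}(s)$, $$\varphi_\gamma^{\rm dr}(s)=\min_{w\in\mathbb R^p}\{\varphi_2(w)+\varphi_1(u)+\langle\nabla\varphi_1(u),w-u\rangle+\tfrac1{2\gamma}\|w-u\|^2\}.$$ Regular subdifferential: $v\in\hat\partial h(\bar x)$ iff $\liminf_{x\to\bar x,\,x\ne\bar x}\frac{h(x)-h(\bar x)-\langle v,x-\bar x\rangle}{\|x-\bar x\|}\ge0$. A point $x$ is stationary for $\varphi$ if $0\in\hat\partial\varphi(x)$.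 *)

theory Defs
  imports "HOL-Analysis.Analysis" "HOL-Library.Landau_Symbols"
begin

definition grad :: "('a::real_inner \<Rightarrow> real) \<Rightarrow> 'a \<Rightarrow> 'a" where
  "grad f x = (THE D. GDERIV f x :> D)"

definition L_smooth :: "real \<Rightarrow> ('a::real_inner \<Rightarrow> real) \<Rightarrow> bool" where
  "L_smooth L f \<longleftrightarrow> (\<forall>x. \<exists>D. GDERIV f x :> D) \<and> L-lipschitz_on UNIV (grad f)"

definition hypoconvex :: "real \<Rightarrow> ('a::real_inner \<Rightarrow> real) \<Rightarrow> bool" where
  "hypoconvex \<sigma> f \<longleftrightarrow> convex_on UNIV (\<lambda>x. f x - \<sigma> / 2 * (norm x)\<^sup>2)"

definition proper :: "('a \<Rightarrow> ereal) \<Rightarrow> bool" where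
  "proper h \<longleftrightarrow> (\<forall>x. h x \<noteq> -\<infinity>) \<and> (\<exists>x. h x \<noteq> \<infinity>)"

definition lsc :: "('a::topological_space \<Rightarrow> ereal) \<Rightarrow> bool" where
  "lsc h \<longleftrightarrow> (\<forall>x. h x \<le> Liminf (at x) h)"

definition argmin :: "('a \<Rightarrow> ereal) \<Rightarrow> 'a set" where
  "argmin h = {x. is_arg_min h (\<lambda>_. True) x}"

definition prox :: "real \<Rightarrow> ('a::real_normed_vector \<Rightarrow> ereal) \<Rightarrow> 'a \<Rightarrow> 'a set" where
  "prox \<gamma> h x = argmin (\<lambda>w. h w + ereal (1 / (2 * \<gamma>) * (norm (w - x))\<^sup>2))"

definition neg_part :: "real \<Rightarrow> real" where
  "neg_part r = max 0 (- r)"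

definition DRS ::
  "('a::real_normed_vector \<Rightarrow> real) \<Rightarrow> ('a \<Rightarrow> ereal) \<Rightarrow> real \<Rightarrow> real \<Rightarrow>
   (nat \<Rightarrow> 'a) \<Rightarrow> (nat \<Rightarrow> 'a) \<Rightarrow> (nat \<Rightarrow> 'a) \<Rightarrow> bool" where
  "DRS \<phi>1 \<phi>2 \<gamma> lam s u v \<longleftrightarrow>
     (\<forall>k. u k \<in> prox \<gamma> (\<lambda>x. ereal (\<phi>1 x)) (s k) \<and>
          v k \<in> prox \<gamma> \<phi>2 (2 *\<^sub>R u k - s k) \<and>
          s (Suc k) = s k + lam *\<^sub>R (v k - u k))"

text \<open>The Douglas-Rachford envelope. The description of \<open>u\<close> is meaningful for
  \<open>0 < \<gamma> < 1/L\<close>, when the proximal map of \<open>\<phi>1\<close> is single valued; the minimum over \<open>w\<close>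
  is written as an infimum in the extended reals.\<close>

definition DR_envelope ::
  "('a::real_inner \<Rightarrow> real) \<Rightarrow> ('a \<Rightarrow> ereal) \<Rightarrow> real \<Rightarrow> 'a \<Rightarrow> ereal" where
  "DR_envelope \<phi>1 \<phi>2 \<gamma> s =
     (let u = (THE u. u \<in> prox \<gamma> (\<lambda>x. ereal (\<phi>1 x)) s) in
      INF w. \<phi>2 w + ereal (\<phi>1 u + inner (grad \<phi>1 u) (w - u) + 1 / (2 * \<gamma>) * (norm (w - u))\<^sup>2))"

text \<open>The regular subdifferential is empty outside the effective domain; without this guard
  the convention \<open>\<infinity> - \<infinity> = \<infinity>\<close> for \<^typ>\<open>ereal\<close> would admit spurious subgradients there.\<close>

definition regular_subdiff :: "('a::real_inner \<Rightarrow> ereal) \<Rightarrow> 'a \<Rightarrow> 'a set" where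
  "regular_subdiff h xb =
     {v. \<bar>h xb\<bar> \<noteq> \<infinity> \<and>
         0 \<le> Liminf (at xb) (\<lambda>x. (h x - h xb - ereal (inner v (x - xb))) / ereal (norm (x - xb)))}"

definition stationary :: "('a::real_inner \<Rightarrow> ereal) \<Rightarrow> 'a \<Rightarrow> bool" where
  "stationary h x \<longleftrightarrow> 0 \<in> regular_subdiff h x"

text \<open>Extended-real valued, so that the distance to the empty set is \<open>\<infinity>\<close>
  (\<^const>\<open>infdist\<close> would give \<open>0\<close>).\<close>

definition edist_set :: "'a::metric_space \<Rightarrow> 'a set \<Rightarrow> ereal" where
  "edist_set x A = (INF y\<in>A. ereal (dist x y))"

definition cluster_points :: "(nat \<Rightarrow> 'a::topological_space) \<Rightarrow> 'a set" where
  "cluster_points X = {x. \<exists>r. strict_mono r \<and> (X \<circ> r) \<longlonglongrightarrow> x}"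

definition bounded_level_sets :: "('a::metric_space \<Rightarrow> ereal) \<Rightarrow> bool" where
  "bounded_level_sets h \<longleftrightarrow> (\<forall>\<alpha>::real. bounded {x. h x \<le> ereal \<alpha>})"

end

theory Submission
  imports Defs
begin

text \<open>
  The Douglas-Rachford envelope is a Lyapunov function for the splitting. Its value at \<open>s\<close> is the
  minimum over \<open>w\<close> of \<open>\<phi>2 w\<close> plus the linearisation of \<open>\<phi>1\<close> at \<open>u\<close> plus a proximal penalty, and the
  minimum is attained at the point \<open>v\<close> of the iteration. Testing the next minimisation at the old
  \<open>v\<close> eliminates \<open>\<phi>2\<close>: with \<open>d\<close> the difference of two successive points \<open>u\<close> and \<open>e\<close> that of their
  gradients, the envelope decreases by at least

    \<open>D + (2 - lam) / (2 \<gamma> lam) \<parallel>d\<parallel>\<^sup>2 - (\<gamma> / lam) \<parallel>e\<parallel>\<^sup>2\<close>,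

  where \<open>D\<close> is a Bregman distance of \<open>\<phi>1\<close> (\<open>prox_grad_model_step\<close>). Smoothness and hypoconvexity
  together bound \<open>D\<close> from below by \<open>\<sigma>/2 \<parallel>d\<parallel>\<^sup>2 + \<parallel>e - \<sigma> d\<parallel>\<^sup>2 / (2 (L - \<sigma>))\<close>, and they make
  \<open>e - \<sigma> d\<close> cocoercive (\<open>hypoconvex_bregman_cocoercive\<close>). The decrease is thereby at least a quadratic
  form in \<open>(d, e)\<close>, and in both parameter ranges this form dominates a positive multiple of
  \<open>\<parallel>d\<parallel>\<^sup>2\<close> (\<open>decrease_constant_nonpos_modulus\<close>, \<open>decrease_constant_pos_modulus\<close>). As
  \<open>lam \<parallel>u - v\<parallel> \<le> 2 \<parallel>d\<parallel>\<close>, each step decreases the envelope by a multiple of \<open>\<parallel>u - v\<parallel>\<^sup>2\<close>.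

  The envelope lies above the objective at \<open>v\<close> because \<open>\<gamma> < 1/L\<close>, hence it is bounded below and
  converges. So the squared residuals are summable, which yields the vanishing residual and its rate.
  At a cluster point, lower semicontinuity and the minimum property of the envelope identify the value of
  the objective with the limit, and the same minimum property supplies a quadratic minorant with slope zero,
  that is stationarity. The subgradient at \<open>v\<close> is the difference at \<open>u\<close> and \<open>v\<close> of the gradient step
  \<open>x - \<gamma> \<nabla>\<phi>1(x)\<close>, divided by \<open>\<gamma>\<close>, and that map is \<open>(1 - \<gamma> \<sigma>)\<close>-Lipschitz
  (\<open>gradient_step_lipschitz\<close>). Finally, the objective at \<open>v\<close> never exceeds the initial envelope value,
  so bounded level sets bound the iterates.
\<close>

section \<open>Gradients of smooth hypoconvex functions\<close>

text \<open>In \<open>bregman f g x y\<close> the map \<open>g\<close> stands for the gradient of \<open>f\<close>. It is a separate argument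
  because the two-sided bounds below, and what follows from them, are pure inequalities: they apply
  to \<open>f\<close> shifted by a quadratic without differentiating again.\<close>

definition bregman :: "('a::real_inner \<Rightarrow> real) \<Rightarrow> ('a \<Rightarrow> 'a) \<Rightarrow> 'a \<Rightarrow> 'a \<Rightarrow> real" where
  "bregman f g x y = f x - f y - inner (g y) (x - y)"

lemma GDERIV_unique:
  fixes f :: "'a::real_inner \<Rightarrow> real"
  assumes "GDERIV f x :> D" "GDERIV f x :> D'"
  shows "D = D'"
proof -
  have "(\<lambda>h. inner h D) = (\<lambda>h. inner h D')"
    using assms unfolding gderiv_def by (rule has_derivative_unique)
  then have "inner (D - D') D = inner (D - D') D'" by (rule fun_cong)
  then have "inner (D - D') (D - D') = 0" by (simp add: inner_diff_right)
  then show ?thesis by simp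
qed

lemma L_smooth_GDERIV:
  assumes "L_smooth L f"
  shows "GDERIV f x :> grad f x"
proof -
  obtain D where D: "GDERIV f x :> D" using assms by (auto simp: L_smooth_def)
  then have "grad f x = D" unfolding grad_def by (blast intro: GDERIV_unique)
  with D show ?thesis by simp
qed

lemma L_smooth_dist_grad:
  assumes "L_smooth L f"
  shows "norm (grad f x - grad f y) \<le> L * norm (x - y)"
  using assms by (auto simp: L_smooth_def lipschitz_on_def dist_norm)

lemma DERIV_along_line:
  assumes "L_smooth L f"
  shows "((\<lambda>t. f (x + t *\<^sub>R d)) has_real_derivative inner (grad f (x + t *\<^sub>R d)) d) (at t)"
proof -
  have "((\<lambda>t. x + t *\<^sub>R d) has_derivative (\<lambda>h. h *\<^sub>R d)) (at t)"
    by (auto intro!: derivative_eq_intros)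
  moreover have "(f has_derivative (\<lambda>h. inner h (grad f (x + t *\<^sub>R d)))) (at (x + t *\<^sub>R d))"
    using L_smooth_GDERIV[OF assms] by (simp add: gderiv_def)
  ultimately have "((\<lambda>t. f (x + t *\<^sub>R d)) has_derivative
      (\<lambda>h. inner (h *\<^sub>R d) (grad f (x + t *\<^sub>R d)))) (at t)"
    by (rule has_derivative_compose)
  then show ?thesis
    by (simp add: has_field_derivative_def inner_commute mult.commute[of _ "inner _ _"])
qed

text \<open>The descent lemma: along the segment from \<open>y\<close> to \<open>x\<close> the difference of the two sides has a
  derivative of constant sign, by the Lipschitz bound on the gradient.\<close>

lemma bregman_le_L_smooth:
  assumes "L_smooth L f"
  shows "bregman f (grad f) x y \<le> L / 2 * (norm (x - y))\<^sup>2"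
proof -
  define d where "d = x - y"
  define p where "p t = f (y + t *\<^sub>R d) - t * inner (grad f y) d - L / 2 * t\<^sup>2 * (norm d)\<^sup>2" for t
  have deriv: "(p has_real_derivative
      inner (grad f (y + t *\<^sub>R d)) d - inner (grad f y) d - L * t * (norm d)\<^sup>2) (at t)" for t
    unfolding p_def
    by (rule derivative_eq_intros DERIV_along_line[OF assms] refl)+ (simp add: algebra_simps)
  have nonpos: "inner (grad f (y + t *\<^sub>R d)) d - inner (grad f y) d - L * t * (norm d)\<^sup>2 \<le> 0"
    if "0 \<le> t" for t
  proof -
    have "inner (grad f (y + t *\<^sub>R d) - grad f y) d \<le> norm (grad f (y + t *\<^sub>R d) - grad f y) * norm d"
      by (rule norm_cauchy_schwarz)
    also have "\<dots> \<le> (L * norm ((y + t *\<^sub>R d) - y)) * norm d"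
      by (intro mult_right_mono L_smooth_dist_grad assms) simp
    also have "\<dots> = L * t * (norm d)\<^sup>2" using that by (simp add: power2_eq_square)
    finally show ?thesis by (simp add: inner_diff_left)
  qed
  have "p 1 \<le> p 0"
  proof (rule DERIV_nonpos_imp_nonincreasing[of 0 1 p])
    fix t :: real assume "0 \<le> t"
    show "\<exists>y. (p has_real_derivative y) (at t) \<and> y \<le> 0"
      by (intro exI conjI) (rule deriv, rule nonpos[OF \<open>0 \<le> t\<close>])
  qed simp
  then show ?thesis by (simp add: p_def d_def bregman_def)
qed

lemma norm_power2_shift:
  "(norm (x::'a::real_inner))\<^sup>2 - (norm y)\<^sup>2 - 2 * inner y (x - y) = (norm (x - y))\<^sup>2"
  by (simp add: power2_norm_eq_inner inner_diff_left inner_diff_right inner_commute)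

lemma bregman_minus_quadratic:
  "bregman (\<lambda>x. f x - \<sigma> / 2 * (norm x)\<^sup>2) (\<lambda>x. g x - \<sigma> *\<^sub>R x) x y
     = bregman f g x y - \<sigma> / 2 * (norm (x - y))\<^sup>2"
  unfolding bregman_def norm_power2_shift[symmetric]
  by (simp add: inner_diff_left inner_diff_right algebra_simps)

text \<open>Restricted to the line through \<open>y\<close> and \<open>x\<close>, the convex function \<open>f - \<sigma>/2 \<parallel>\<cdot>\<parallel>\<^sup>2\<close> lies above
  its tangent at \<open>y\<close>; completing the square turns this into the bound.\<close>

lemma bregman_ge_hypoconvex:
  assumes "L_smooth L f" and "hypoconvex \<sigma> f"
  shows "\<sigma> / 2 * (norm (x - y))\<^sup>2 \<le> bregman f (grad f) x y"
proof -
  define d where "d = x - y"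
  define h where "h x = f x - \<sigma> / 2 * (norm x)\<^sup>2" for x
  have "convex_on UNIV h" using assms(2) by (simp add: hypoconvex_def h_def[abs_def])
  have conv: "convex_on UNIV (\<lambda>t. h (y + t *\<^sub>R d))"
  proof (rule convex_onI)
    fix t a b :: real assume t: "0 < t" "t < 1"
    have "y + ((1 - t) *\<^sub>R a + t *\<^sub>R b) *\<^sub>R d = (1 - t) *\<^sub>R (y + a *\<^sub>R d) + t *\<^sub>R (y + b *\<^sub>R d)"
      by (simp add: algebra_simps)
    then show "h (y + ((1 - t) *\<^sub>R a + t *\<^sub>R b) *\<^sub>R d)
        \<le> (1 - t) * h (y + a *\<^sub>R d) + t * h (y + b *\<^sub>R d)"
      using convex_onD[OF \<open>convex_on UNIV h\<close>, of t "y + a *\<^sub>R d" "y + b *\<^sub>R d"] t by simp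
  qed simp
  have eq: "(\<lambda>t. h (y + t *\<^sub>R d)) =
      (\<lambda>t. f (y + t *\<^sub>R d) - \<sigma> / 2 * ((norm y)\<^sup>2 + 2 * t * inner y d + t\<^sup>2 * (norm d)\<^sup>2))"
    unfolding h_def power2_norm_eq_inner
    by (simp add: inner_add_left inner_add_right inner_commute power2_eq_square algebra_simps)
  have "((\<lambda>t. h (y + t *\<^sub>R d)) has_real_derivative inner (grad f y - \<sigma> *\<^sub>R y) d) (at 0)"
    unfolding eq
    by (rule derivative_eq_intros DERIV_along_line[OF assms(1)] refl)+
      (simp add: inner_diff_left)
  then have "h (y + 1 *\<^sub>R d) - h (y + 0 *\<^sub>R d) \<ge> inner (grad f y - \<sigma> *\<^sub>R y) d * (1 - 0)"
    by (intro convex_on_imp_above_tangent[OF conv]) auto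
  then have "0 \<le> bregman h (\<lambda>x. grad f x - \<sigma> *\<^sub>R x) x y"
    by (simp add: bregman_def d_def)
  then show ?thesis
    unfolding h_def bregman_minus_quadratic by simp
qed

text \<open>Compare the lower model at \<open>y\<close> with the upper model at \<open>x\<close>, both at the point
  \<open>x - t (g x - g y)\<close>: this gives \<open>(t - M t\<^sup>2/2) \<parallel>g x - g y\<parallel>\<^sup>2 \<le> bregman f g x y\<close>, and \<open>t = 1/M\<close> is best.
  The case \<open>M = 0\<close> is included, because modulus and smoothness constant may coincide; there
  \<open>z / 0 = 0\<close> makes the first bound trivial and the second one says that \<open>g\<close> is constant.\<close>

lemma bregman_cocoercive:
  assumes low: "\<And>x y. 0 \<le> bregman f g x y"
    and up: "\<And>x y. bregman f g x y \<le> M / 2 * (norm (x - y))\<^sup>2"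
    and "0 \<le> M"
  shows "(norm (g x - g y))\<^sup>2 / (2 * M) \<le> bregman f g x y"
    and "(norm (g x - g y))\<^sup>2 \<le> M * inner (g x - g y) (x - y)"
proof -
  have step: "(t - M / 2 * t\<^sup>2) * (norm (g x - g y))\<^sup>2 \<le> bregman f g x y" for x y t
  proof -
    define w where "w = x - t *\<^sub>R (g x - g y)"
    have "bregman f g x y + bregman f g w x - bregman f g w y
          = - inner (g x - g y) (w - x)"
      by (simp add: bregman_def inner_diff_left inner_diff_right)
    also have "\<dots> = t * (norm (g x - g y))\<^sup>2"
      by (simp add: w_def power2_norm_eq_inner)
    finally have "t * (norm (g x - g y))\<^sup>2 \<le> bregman f g x y + bregman f g w x"
      using low[of w y] by simp
    moreover have "bregman f g w x \<le> M / 2 * (t\<^sup>2 * (norm (g x - g y))\<^sup>2)"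
      using up[of w x] by (simp add: w_def power_mult_distrib)
    ultimately show ?thesis by (simp add: algebra_simps)
  qed
  have 1: "(norm (g x - g y))\<^sup>2 / (2 * M) \<le> bregman f g x y" for x y
  proof (cases "M = 0")
    case True
    with low[of x y] show ?thesis by simp
  next
    case False
    with step[of "1 / M" x y] show ?thesis by (simp add: power2_eq_square field_simps)
  qed
  then show "(norm (g x - g y))\<^sup>2 / (2 * M) \<le> bregman f g x y" .
  show "(norm (g x - g y))\<^sup>2 \<le> M * inner (g x - g y) (x - y)"
  proof (cases "M = 0")
    case True
    have "(norm (g x - g y))\<^sup>2 \<le> bregman f g x y" using step[of 1 x y] True by simp
    also have "\<dots> \<le> 0" using up[of x y] True by simp
    finally show ?thesis using True by simp
  next
    case False
    have "bregman f g x y + bregman f g y x = inner (g x - g y) (x - y)"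
      by (simp add: bregman_def inner_diff_left inner_diff_right)
    with 1[of x y] 1[of y x] have "(norm (g x - g y))\<^sup>2 / M \<le> inner (g x - g y) (x - y)"
      by (simp add: norm_minus_commute)
    with False \<open>0 \<le> M\<close> show ?thesis by (simp add: field_simps)
  qed
qed

text \<open>Cocoercivity of \<open>f - \<sigma>/2 \<parallel>\<cdot>\<parallel>\<^sup>2\<close>, which is convex and \<open>(L - \<sigma>)\<close>-smooth, rewritten for \<open>f\<close>. This is
  the full strength in which smoothness and hypoconvexity enter the decrease of the envelope.\<close>

lemma hypoconvex_bregman_cocoercive:
  assumes "L_smooth L f" "hypoconvex \<sigma> f" "\<sigma> \<le> L"
  defines "z \<equiv> \<lambda>x y. (grad f x - grad f y) - \<sigma> *\<^sub>R (x - y)"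
  shows "\<sigma> / 2 * (norm (x - y))\<^sup>2 + (norm (z x y))\<^sup>2 / (2 * (L - \<sigma>)) \<le> bregman f (grad f) x y"
    and "(norm (z x y))\<^sup>2 \<le> (L - \<sigma>) * inner (z x y) (x - y)"
proof -
  let ?h = "\<lambda>x. f x - \<sigma> / 2 * (norm x)\<^sup>2" and ?g = "\<lambda>x. grad f x - \<sigma> *\<^sub>R x"
  have low: "0 \<le> bregman ?h ?g x y" for x y
    unfolding bregman_minus_quadratic using bregman_ge_hypoconvex[OF assms(1,2), of x y] by simp
  have up: "bregman ?h ?g x y \<le> (L - \<sigma>) / 2 * (norm (x - y))\<^sup>2" for x y
    unfolding bregman_minus_quadratic using bregman_le_L_smooth[OF assms(1), of x y]
    by (simp add: diff_divide_distrib left_diff_distrib)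
  have z: "z x y = ?g x - ?g y" by (simp add: z_def algebra_simps)
  show "\<sigma> / 2 * (norm (x - y))\<^sup>2 + (norm (z x y))\<^sup>2 / (2 * (L - \<sigma>)) \<le> bregman f (grad f) x y"
    using bregman_cocoercive(1)[OF low up, of x y] \<open>\<sigma> \<le> L\<close>
    unfolding z bregman_minus_quadratic by simp
  show "(norm (z x y))\<^sup>2 \<le> (L - \<sigma>) * inner (z x y) (x - y)"
    using bregman_cocoercive(2)[OF low up, of x y] \<open>\<sigma> \<le> L\<close> by (simp add: z)
qed

text \<open>The gradient step is the gradient of \<open>\<parallel>\<cdot>\<parallel>\<^sup>2/2 - \<gamma> f\<close>, which is convex by the descent lemma
  and \<open>(1 - \<gamma> \<sigma>)\<close>-smooth by hypoconvexity. Cocoercivity then yields the sharp Lipschitz constant;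
  the triangle inequality would only give \<open>1 + \<gamma> L\<close>.\<close>

lemma gradient_step_lipschitz:
  assumes "L_smooth L f" "hypoconvex \<sigma> f" "\<sigma> \<le> L" "0 < \<gamma>" "\<gamma> * L < 1"
  shows "norm ((x - \<gamma> *\<^sub>R grad f x) - (y - \<gamma> *\<^sub>R grad f y)) \<le> (1 - \<gamma> * \<sigma>) * norm (x - y)"
proof -
  let ?F = "\<lambda>x. (norm x)\<^sup>2 / 2 - \<gamma> * f x" and ?G = "\<lambda>x. x - \<gamma> *\<^sub>R grad f x"
  have eq: "bregman ?F ?G x y = (norm (x - y))\<^sup>2 / 2 - \<gamma> * bregman f (grad f) x y" for x y
  proof -
    have "inner (y - \<gamma> *\<^sub>R grad f y) (x - y) = inner y (x - y) - \<gamma> * inner (grad f y) (x - y)"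
      by (simp add: inner_diff_left)
    then show ?thesis
      using norm_power2_shift[of x y] by (simp add: bregman_def right_diff_distrib)
  qed
  have \<gamma>\<sigma>: "\<gamma> * \<sigma> < 1"
    using mult_left_mono[OF \<open>\<sigma> \<le> L\<close>, of \<gamma>] assms(4,5) by linarith
  have low: "0 \<le> bregman ?F ?G x y" for x y
  proof -
    have "\<gamma> * bregman f (grad f) x y \<le> \<gamma> * (L / 2 * (norm (x - y))\<^sup>2)"
      using bregman_le_L_smooth[OF assms(1), of x y] \<open>0 < \<gamma>\<close> by (intro mult_left_mono) auto
    also have "\<dots> = (\<gamma> * L) * ((norm (x - y))\<^sup>2 / 2)" by simp
    also have "\<dots> \<le> 1 * ((norm (x - y))\<^sup>2 / 2)" using assms(5) by (intro mult_right_mono) auto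
    finally show ?thesis by (simp add: eq)
  qed
  have up: "bregman ?F ?G x y \<le> (1 - \<gamma> * \<sigma>) / 2 * (norm (x - y))\<^sup>2" for x y
  proof -
    have "\<gamma> * (\<sigma> / 2 * (norm (x - y))\<^sup>2) \<le> \<gamma> * bregman f (grad f) x y"
      using bregman_ge_hypoconvex[OF assms(1,2), of x y] \<open>0 < \<gamma>\<close> by (intro mult_left_mono) auto
    then show ?thesis by (simp add: eq left_diff_distrib diff_divide_distrib)
  qed
  have "(norm (?G x - ?G y))\<^sup>2 \<le> (1 - \<gamma> * \<sigma>) * inner (?G x - ?G y) (x - y)"
    using \<gamma>\<sigma> by (intro bregman_cocoercive(2)[OF low up]) simp
  also have "\<dots> \<le> (1 - \<gamma> * \<sigma>) * (norm (?G x - ?G y) * norm (x - y))"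
    using \<gamma>\<sigma> by (intro mult_left_mono norm_cauchy_schwarz) simp
  finally have "norm (?G x - ?G y) * norm (?G x - ?G y)
      \<le> norm (?G x - ?G y) * ((1 - \<gamma> * \<sigma>) * norm (x - y))"
    unfolding power2_eq_square by (simp only: mult.left_commute)
  then have "norm (?G x - ?G y) = 0 \<or> norm (?G x - ?G y) \<le> (1 - \<gamma> * \<sigma>) * norm (x - y)"
    by (metis mult_le_cancel_left_pos norm_ge_zero order_less_le)
  moreover have "0 \<le> (1 - \<gamma> * \<sigma>) * norm (x - y)" using \<gamma>\<sigma> by simp
  ultimately show ?thesis by linarith
qed

lemma hypoconvex_mono:
  assumes "hypoconvex \<sigma> f" "\<tau> \<le> \<sigma>"
  shows "hypoconvex \<tau> (f :: 'a::real_inner \<Rightarrow> real)"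
proof -
  have "convex_on UNIV (\<lambda>x::'a. (norm x)\<^sup>2)"
  proof (rule convex_onI)
    fix t :: real and x y :: 'a assume t: "0 < t" "t < 1"
    have "(1 - t) * (norm x)\<^sup>2 + t * (norm y)\<^sup>2 - (norm ((1 - t) *\<^sub>R x + t *\<^sub>R y))\<^sup>2
        = t * (1 - t) * (norm (x - y))\<^sup>2"
      unfolding power2_norm_eq_inner
      by (simp add: inner_diff_left inner_diff_right inner_add_left inner_add_right
          inner_commute[of y x]) (simp add: algebra_simps)
    also have "\<dots> \<ge> 0" using t by simp
    finally show "(norm ((1 - t) *\<^sub>R x + t *\<^sub>R y))\<^sup>2 \<le> (1 - t) * (norm x)\<^sup>2 + t * (norm y)\<^sup>2"
      by simp
  qed simp
  then have "convex_on UNIV (\<lambda>x::'a. (\<sigma> - \<tau>) / 2 * (norm x)\<^sup>2)"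
    using assms(2) by (intro convex_on_cmul) auto
  from convex_on_add[OF assms(1)[unfolded hypoconvex_def] this] show ?thesis
    by (simp add: hypoconvex_def algebra_simps diff_divide_distrib)
qed

section \<open>Two lower bounds for quadratic expressions\<close>

text \<open>In the application \<open>d\<close> is the difference of two points, \<open>z + \<sigma> d\<close> the difference of their
  gradients and \<open>D\<close> the Bregman distance, so that the premises are those provided by cocoercivity and
  the right-hand side is the decrease of the envelope. For a quadratic function of curvature \<open>t\<close> the
  right-hand side is \<open>(1 - \<gamma> t) (2 + 2 \<gamma> t - lam) \<parallel>d\<parallel>\<^sup>2 / (2 \<gamma> lam)\<close>. The proof shows that for a
  nonpositive modulus the extreme curvatures \<open>\<sigma>\<close> and \<open>L\<close> are the worst ones, and the
  parameters make the coefficient positive at both.\<close>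

lemma decrease_constant_nonpos_modulus:
  fixes L \<sigma> \<gamma> lam :: real
  assumes "0 < L" "\<sigma> \<le> 0" "0 < \<gamma>" "0 < lam" "\<gamma> * L < 1" "lam < 2 + 2 * \<gamma> * \<sigma>"
  defines "M \<equiv> L - \<sigma>"
  obtains c where "0 < c"
    and "\<And>(z::'a::real_inner) d D. \<lbrakk>(norm z)\<^sup>2 \<le> M * inner z d;
        \<sigma> / 2 * (norm d)\<^sup>2 + (norm z)\<^sup>2 / (2 * M) \<le> D\<rbrakk>
      \<Longrightarrow> c * (norm d)\<^sup>2
        \<le> D + (2 - lam) / (2 * \<gamma> * lam) * (norm d)\<^sup>2 - \<gamma> / lam * (norm (z + \<sigma> *\<^sub>R d))\<^sup>2"
proof -
  \<comment> \<open>\<open>B t\<close> is the coefficient for curvature \<open>t\<close>, multiplied by \<open>2 * \<gamma> * lam\<close>.\<close>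
  define B where "B t = (1 - \<gamma> * t) * (2 + 2 * \<gamma> * t - lam)" for t
  define c where "c = min (B \<sigma>) (B L) / (2 * \<gamma> * lam)"
  have "0 < M" using assms by (simp add: M_def)
  have "\<gamma> * \<sigma> \<le> 0" using assms by (simp add: mult_nonneg_nonpos)
  have "0 < \<gamma> * L" using assms by simp
  have "0 < B \<sigma>" unfolding B_def using \<open>\<gamma> * \<sigma> \<le> 0\<close> assms(6) by (intro mult_pos_pos) auto
  have "0 < B L" unfolding B_def
    using \<open>\<gamma> * \<sigma> \<le> 0\<close> \<open>0 < \<gamma> * L\<close> assms(5,6) by (intro mult_pos_pos) auto
  show ?thesis
  proof (rule that)
    show "0 < c" using \<open>0 < B \<sigma>\<close> \<open>0 < B L\<close> assms by (simp add: c_def)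
    fix z d :: 'a and D :: real
    define N P Z where "N = (norm d)\<^sup>2" and "P = inner z d" and "Z = (norm z)\<^sup>2"
    assume "(norm z)\<^sup>2 \<le> M * inner z d"
      and "\<sigma> / 2 * (norm d)\<^sup>2 + (norm z)\<^sup>2 / (2 * M) \<le> D"
    then have Z: "0 \<le> Z" "Z \<le> M * P" and D: "\<sigma> / 2 * N + Z / (2 * M) \<le> D"
      by (simp_all add: N_def P_def Z_def)
    have CS: "0 \<le> Z - 2 * M * P + M\<^sup>2 * N"
      unfolding N_def P_def Z_def power2_norm_eq_inner using inner_ge_zero[of "z - M *\<^sub>R d"]
      by (simp add: inner_diff_left inner_diff_right inner_commute[of d z] power2_eq_square
          algebra_simps)
    have e: "(norm (z + \<sigma> *\<^sub>R d))\<^sup>2 = Z + 2 * \<sigma> * P + \<sigma>\<^sup>2 * N"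
      unfolding N_def P_def Z_def power2_norm_eq_inner
      by (simp add: inner_add_left inner_add_right inner_commute[of d z] power2_eq_square
          algebra_simps)
    define R where "R = D + (2 - lam) / (2 * \<gamma> * lam) * N - \<gamma> / lam * (Z + 2 * \<sigma> * P + \<sigma>\<^sup>2 * N)"
    define a where "a = \<gamma> * lam / M - 2 * \<gamma>\<^sup>2"
    have P0: "0 \<le> P" using Z \<open>0 < M\<close> by (metis order_trans zero_le_mult_iff not_less order_less_le)
    have "M * P \<le> M * (M * N)" using Z CS by (simp add: power2_eq_square)
    then have PN: "P \<le> M * N" using \<open>0 < M\<close> by simp
    then have N0: "0 \<le> N" using P0 \<open>0 < M\<close> by (metis order_trans zero_le_mult_iff not_less order_less_le)
    have "2 * \<gamma> * lam * R
        = 2 * \<gamma> * lam * D + (2 - lam) * N - 2 * \<gamma>\<^sup>2 * (Z + 2 * \<sigma> * P + \<sigma>\<^sup>2 * N)"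
      using assms(3,4) by (simp add: R_def field_simps power2_eq_square)
    moreover have "2 * \<gamma> * lam * (\<sigma> / 2 * N + Z / (2 * M)) \<le> 2 * \<gamma> * lam * D"
      using D assms(3,4) by (intro mult_left_mono) auto
    ultimately have R: "B \<sigma> * N + a * Z - 4 * \<gamma>\<^sup>2 * \<sigma> * P \<le> 2 * \<gamma> * lam * R"
      by (simp add: B_def a_def power2_eq_square algebra_simps)
    have "min (B \<sigma>) (B L) * N \<le> B \<sigma> * N + a * Z - 4 * \<gamma>\<^sup>2 * \<sigma> * P"
    proof (cases "0 \<le> a")
      case True
      have "\<gamma>\<^sup>2 * \<sigma> * P \<le> 0" using assms P0 by (simp add: mult_nonneg_nonpos mult_nonpos_nonneg)
      moreover have "min (B \<sigma>) (B L) * N \<le> B \<sigma> * N" using N0 by (intro mult_right_mono) auto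
      ultimately show ?thesis using mult_nonneg_nonneg[OF True Z(1)] by linarith
    next
      case False
      define b where "b = a * M - 4 * \<gamma>\<^sup>2 * \<sigma>"
      have "a * M = \<gamma> * lam - 2 * \<gamma>\<^sup>2 * M" using \<open>0 < M\<close> by (simp add: a_def field_simps)
      then have b: "b = \<gamma> * lam - 2 * \<gamma>\<^sup>2 * (L + \<sigma>)" by (simp add: b_def M_def algebra_simps)
      have bL: "B L = B \<sigma> + b * M"
        unfolding b by (simp add: B_def M_def power2_eq_square algebra_simps)
      \<comment> \<open>Eliminating \<open>Z\<close> leaves an expression affine in \<open>P\<close> on \<open>[0, M * N]\<close>, with extreme values
        \<open>B \<sigma> * N\<close> and \<open>B L * N\<close>.\<close>
      have "a * (M * P) \<le> a * Z" using False Z by (intro mult_left_mono_neg) auto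
      then have "B \<sigma> * N + b * P \<le> B \<sigma> * N + a * Z - 4 * \<gamma>\<^sup>2 * \<sigma> * P"
        by (simp add: b_def algebra_simps)
      moreover have "min (B \<sigma>) (B L) * N \<le> B \<sigma> * N + b * P"
      proof (cases "0 \<le> b")
        case True
        have "min (B \<sigma>) (B L) * N \<le> B \<sigma> * N" using N0 by (intro mult_right_mono) auto
        with mult_nonneg_nonneg[OF True P0] show ?thesis by linarith
      next
        case False
        have "min (B \<sigma>) (B L) * N \<le> B L * N" using N0 by (intro mult_right_mono) auto
        moreover have "b * (M * N) \<le> b * P" using False PN by (intro mult_left_mono_neg) auto
        ultimately show ?thesis by (simp add: bL algebra_simps)
      qed
      ultimately show ?thesis by linarith
    qed
    with R have "min (B \<sigma>) (B L) * N \<le> 2 * \<gamma> * lam * R" by linarith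
    then have "c * N \<le> R"
      using assms(3,4) by (simp add: c_def field_simps)
    then show "c * (norm d)\<^sup>2
        \<le> D + (2 - lam) / (2 * \<gamma> * lam) * (norm d)\<^sup>2 - \<gamma> / lam * (norm (z + \<sigma> *\<^sub>R d))\<^sup>2"
      unfolding e by (simp add: R_def N_def)
  qed
qed

text \<open>For \<open>lam \<ge> 2\<close> intermediate curvatures may be worse than the extreme ones. Here the bound comes from
  discarding a multiple of the square \<open>\<parallel>z - M d\<parallel>\<^sup>2\<close>; the remaining coefficient of \<open>\<parallel>d\<parallel>\<^sup>2\<close> is what
  \<open>cond\<close> makes positive. If \<open>M = 0\<close> then \<open>z = 0\<close> and the terms with \<open>z\<close> vanish.\<close>

lemma decrease_constant_pos_modulus:
  fixes L \<sigma> \<gamma> lam :: real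
  assumes "0 < \<sigma>" "\<sigma> \<le> L" "0 < \<gamma>" "2 \<le> lam" "\<gamma> * L < 1"
    and cond: "2 * \<gamma>\<^sup>2 * \<sigma> * L - \<gamma> * \<sigma> * lam + lam - 2 < 0"
  defines "M \<equiv> L - \<sigma>"
  obtains c where "0 < c"
    and "\<And>(z::'a::real_inner) d D. \<lbrakk>(norm z)\<^sup>2 \<le> M * inner z d;
        \<sigma> / 2 * (norm d)\<^sup>2 + (norm z)\<^sup>2 / (2 * M) \<le> D\<rbrakk>
      \<Longrightarrow> c * (norm d)\<^sup>2
        \<le> D + (2 - lam) / (2 * \<gamma> * lam) * (norm d)\<^sup>2 - \<gamma> / lam * (norm (z + \<sigma> *\<^sub>R d))\<^sup>2"
proof -
  define C where "C = 2 - lam + \<gamma> * \<sigma> * lam - 2 * \<gamma>\<^sup>2 * \<sigma> * L"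
  have L: "L = M + \<sigma>" by (simp add: M_def)
  have "0 \<le> M" "0 < lam" using assms by (auto simp: M_def)
  show ?thesis
  proof (rule that)
    show "0 < C / (2 * \<gamma> * lam)" using cond \<open>0 < \<gamma>\<close> \<open>0 < lam\<close> by (simp add: C_def)
    fix z d :: 'a and D :: real
    define N P Z where "N = (norm d)\<^sup>2" and "P = inner z d" and "Z = (norm z)\<^sup>2"
    assume "(norm z)\<^sup>2 \<le> M * inner z d"
      and "\<sigma> / 2 * (norm d)\<^sup>2 + (norm z)\<^sup>2 / (2 * M) \<le> D"
    then have Z: "0 \<le> Z" "Z \<le> M * P" and D: "\<sigma> / 2 * N + Z / (2 * M) \<le> D"
      by (simp_all add: N_def P_def Z_def)
    have CS: "0 \<le> Z - 2 * M * P + M\<^sup>2 * N"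
      unfolding N_def P_def Z_def power2_norm_eq_inner using inner_ge_zero[of "z - M *\<^sub>R d"]
      by (simp add: inner_diff_left inner_diff_right inner_commute[of d z] power2_eq_square
          algebra_simps)
    have e: "(norm (z + \<sigma> *\<^sub>R d))\<^sup>2 = Z + 2 * \<sigma> * P + \<sigma>\<^sup>2 * N"
      unfolding N_def P_def Z_def power2_norm_eq_inner
      by (simp add: inner_add_left inner_add_right inner_commute[of d z] power2_eq_square
          algebra_simps)
    define R where "R = D + (2 - lam) / (2 * \<gamma> * lam) * N - \<gamma> / lam * (Z + 2 * \<sigma> * P + \<sigma>\<^sup>2 * N)"
    have "2 * \<gamma> * lam * R
        = 2 * \<gamma> * lam * D + (2 - lam) * N - 2 * \<gamma>\<^sup>2 * (Z + 2 * \<sigma> * P + \<sigma>\<^sup>2 * N)"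
      using assms(3) \<open>0 < lam\<close> by (simp add: R_def field_simps power2_eq_square)
    moreover have "2 * \<gamma> * lam * (\<sigma> / 2 * N + Z / (2 * M)) \<le> 2 * \<gamma> * lam * D"
      using D assms(3) \<open>0 < lam\<close> by (intro mult_left_mono) auto
    then have "\<gamma> * lam * \<sigma> * N + \<gamma> * lam * (Z / M) \<le> 2 * \<gamma> * lam * D"
      by (simp add: algebra_simps)
    ultimately have R: "C * N + (\<gamma> * lam * (Z / M) - 2 * \<gamma>\<^sup>2 * Z - 4 * \<gamma>\<^sup>2 * \<sigma> * P + 2 * \<gamma>\<^sup>2 * \<sigma> * M * N)
        \<le> 2 * \<gamma> * lam * R"
      unfolding C_def by (simp add: L power2_eq_square algebra_simps)
    have "0 \<le> \<gamma> * lam * (Z / M) - 2 * \<gamma>\<^sup>2 * Z - 4 * \<gamma>\<^sup>2 * \<sigma> * P + 2 * \<gamma>\<^sup>2 * \<sigma> * M * N"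
    proof (cases "M = 0")
      case True
      then have "z = 0" using Z by (simp add: Z_def)
      then have "Z = 0" "P = 0" by (simp_all add: Z_def P_def)
      with True show ?thesis by simp
    next
      case False
      then have "0 < M" using \<open>0 \<le> M\<close> by simp
      have "2 * (\<gamma> * L) \<le> lam" using assms(4,5) by simp
      then have "\<gamma> * (2 * (\<gamma> * L)) * (Z / M) \<le> \<gamma> * lam * (Z / M)"
        using Z \<open>0 < M\<close> \<open>0 < \<gamma>\<close> by (intro mult_right_mono mult_left_mono) auto
      moreover have "\<gamma> * (2 * (\<gamma> * L)) * (Z / M) - 2 * \<gamma>\<^sup>2 * Z - 4 * \<gamma>\<^sup>2 * \<sigma> * P + 2 * \<gamma>\<^sup>2 * \<sigma> * M * N
          = 2 * \<gamma>\<^sup>2 * \<sigma> / M * (Z - 2 * M * P + M\<^sup>2 * N)"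
        using \<open>0 < M\<close> by (simp add: field_simps power2_eq_square M_def)
      moreover have "0 \<le> 2 * \<gamma>\<^sup>2 * \<sigma> / M * (Z - 2 * M * P + M\<^sup>2 * N)"
        using CS \<open>0 < M\<close> \<open>0 < \<sigma>\<close> by (intro mult_nonneg_nonneg) auto
      ultimately show ?thesis by linarith
    qed
    with R have "C * N \<le> 2 * \<gamma> * lam * R" by linarith
    then have "C / (2 * \<gamma> * lam) * N \<le> R"
      using assms(3) \<open>0 < lam\<close> by (simp add: field_simps)
    then show "C / (2 * \<gamma> * lam) * (norm d)\<^sup>2
        \<le> D + (2 - lam) / (2 * \<gamma> * lam) * (norm d)\<^sup>2 - \<gamma> / lam * (norm (z + \<sigma> *\<^sub>R d))\<^sup>2"
      unfolding e by (simp add: R_def N_def)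
  qed
qed

section \<open>Proximal points and the Douglas-Rachford envelope\<close>

lemma prox_le:
  assumes "v \<in> prox \<gamma> h x"
  shows "h v + ereal (1 / (2 * \<gamma>) * (norm (v - x))\<^sup>2) \<le> h w + ereal (1 / (2 * \<gamma>) * (norm (w - x))\<^sup>2)"
  using assms by (auto simp: prox_def argmin_def is_arg_min_def not_less)

lemma prox_finite:
  assumes "proper h" "v \<in> prox \<gamma> h x"
  obtains r where "h v = ereal r"
proof -
  obtain y where "h y \<noteq> \<infinity>" "h y \<noteq> -\<infinity>" using assms(1) by (auto simp: proper_def)
  then have "h v + ereal (1 / (2 * \<gamma>) * (norm (v - x))\<^sup>2) \<noteq> \<infinity>"
    using prox_le[OF assms(2), of y] by (cases "h y") auto
  moreover have "h v \<noteq> -\<infinity>" using assms(1) by (simp add: proper_def)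
  ultimately show ?thesis using that by (cases "h v") auto
qed

text \<open>Fermat's rule, along the direction in which the gradient of the objective itself points.\<close>

lemma prox_smooth_eq:
  assumes "L_smooth L f" "0 < \<gamma>" "u \<in> prox \<gamma> (\<lambda>x. ereal (f x)) s"
  shows "u + \<gamma> *\<^sub>R grad f u = s"
proof -
  define h where "h = grad f u + (1 / \<gamma>) *\<^sub>R (u - s)"
  define q where "q t = f (u + t *\<^sub>R h) + 1 / (2 * \<gamma>) * (norm (u + t *\<^sub>R h - s))\<^sup>2" for t
  have q: "q = (\<lambda>t. f (u + t *\<^sub>R h)
      + 1 / (2 * \<gamma>) * ((norm (u - s))\<^sup>2 + 2 * t * inner (u - s) h + t\<^sup>2 * (norm h)\<^sup>2))"
  proof
    fix t
    have "(norm (u + t *\<^sub>R h - s))\<^sup>2 = (norm ((u - s) + t *\<^sub>R h))\<^sup>2" by (simp add: algebra_simps)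
    also have "\<dots> = (norm (u - s))\<^sup>2 + 2 * t * inner (u - s) h + t\<^sup>2 * (norm h)\<^sup>2"
      unfolding power2_norm_eq_inner
      by (simp add: inner_add_left inner_add_right inner_commute[of h "u - s"] power2_eq_square
          distrib_left)
    finally show "q t = f (u + t *\<^sub>R h)
      + 1 / (2 * \<gamma>) * ((norm (u - s))\<^sup>2 + 2 * t * inner (u - s) h + t\<^sup>2 * (norm h)\<^sup>2)"
      by (simp add: q_def)
  qed
  have "(q has_real_derivative inner (grad f u) h + 1 / \<gamma> * inner (u - s) h) (at 0)"
    unfolding q
    by (rule derivative_eq_intros DERIV_along_line[OF assms(1)] refl)+ simp
  moreover have "\<forall>t. \<bar>0 - t\<bar> < 1 \<longrightarrow> q 0 \<le> q t"
    using prox_le[OF assms(3)] by (auto simp: q_def)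
  ultimately have "inner (grad f u) h + 1 / \<gamma> * inner (u - s) h = 0"
    by (intro DERIV_local_min[of q _ 0 1]) auto
  then have "inner h h = 0" by (simp add: h_def inner_add_left)
  then have "\<gamma> *\<^sub>R h = 0" by simp
  then show ?thesis using assms(2) by (simp add: h_def algebra_simps)
qed

lemma prox_smooth_unique:
  assumes "L_smooth L f" "0 < \<gamma>" "\<gamma> * L < 1"
    and "u \<in> prox \<gamma> (\<lambda>x. ereal (f x)) s" "u' \<in> prox \<gamma> (\<lambda>x. ereal (f x)) s"
  shows "u = u'"
proof (rule ccontr)
  assume "u \<noteq> u'"
  have "u + \<gamma> *\<^sub>R grad f u = u' + \<gamma> *\<^sub>R grad f u'"
    using prox_smooth_eq[OF assms(1,2)] assms(4,5) by simp
  then have "u - u' = \<gamma> *\<^sub>R (grad f u' - grad f u)" by (simp add: algebra_simps)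
  then have "norm (u - u') = \<gamma> * norm (grad f u' - grad f u)" using \<open>0 < \<gamma>\<close> by simp
  also have "\<dots> \<le> \<gamma> * (L * norm (u' - u))"
    using \<open>0 < \<gamma>\<close> by (intro mult_left_mono L_smooth_dist_grad assms) simp
  also have "\<dots> = (\<gamma> * L) * norm (u - u')" by (simp add: norm_minus_commute)
  also have "\<dots> < 1 * norm (u - u')" using \<open>u \<noteq> u'\<close> assms(3) by (intro mult_strict_right_mono) auto
  finally show False by simp
qed

text \<open>The function of \<open>w\<close> that, added to the nonsmooth term, is minimised in the Douglas-Rachford
  envelope: the linearisation of \<open>f\<close> at \<open>u\<close> plus the proximal penalty.\<close>

definition prox_grad_model :: "('a::real_inner \<Rightarrow> real) \<Rightarrow> real \<Rightarrow> 'a \<Rightarrow> 'a \<Rightarrow> real" where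
  "prox_grad_model f \<gamma> u w = f u + inner (grad f u) (w - u) + 1 / (2 * \<gamma>) * (norm (w - u))\<^sup>2"

text \<open>Completing the square: up to a constant, the model is the proximal penalty centred at the gradient
  step. Hence its sum with \<open>h\<close> is minimised by a proximal point of \<open>h\<close> at the gradient step, which is
  the point \<open>2 u - s\<close> of the splitting.\<close>

lemma prox_grad_model_eq:
  assumes "0 < \<gamma>"
  shows "prox_grad_model f \<gamma> u w = (f u - \<gamma> / 2 * (norm (grad f u))\<^sup>2)
    + 1 / (2 * \<gamma>) * (norm (w - (u - \<gamma> *\<^sub>R grad f u)))\<^sup>2"
proof -
  have "(norm (w - (u - \<gamma> *\<^sub>R grad f u)))\<^sup>2 = (norm ((w - u) + \<gamma> *\<^sub>R grad f u))\<^sup>2"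
    by (simp add: algebra_simps)
  also have "\<dots> = (norm (w - u))\<^sup>2 + 2 * \<gamma> * inner (grad f u) (w - u) + \<gamma>\<^sup>2 * (norm (grad f u))\<^sup>2"
    unfolding power2_norm_eq_inner
    by (simp add: inner_add_left inner_add_right inner_commute[of "w - u" "grad f u"]
        power2_eq_square distrib_left)
  finally show ?thesis
    using assms by (simp add: prox_grad_model_def field_simps power2_eq_square)
qed

lemma prox_grad_model_le:
  assumes "0 < \<gamma>" "v \<in> prox \<gamma> h (u - \<gamma> *\<^sub>R grad f u)"
  shows "h v + ereal (prox_grad_model f \<gamma> u v) \<le> h w + ereal (prox_grad_model f \<gamma> u w)"
proof -
  have "h x + ereal (prox_grad_model f \<gamma> u x)
      = (h x + ereal (1 / (2 * \<gamma>) * (norm (x - (u - \<gamma> *\<^sub>R grad f u)))\<^sup>2))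
        + ereal (f u - \<gamma> / 2 * (norm (grad f u))\<^sup>2)" for x
    unfolding prox_grad_model_eq[OF assms(1)] by (cases "h x") auto
  then show ?thesis
    using prox_le[OF assms(2), of w] by (auto intro: add_right_mono)
qed

lemma DR_envelope_eq:
  assumes "L_smooth L f" "0 < \<gamma>" "\<gamma> * L < 1"
    and u: "u \<in> prox \<gamma> (\<lambda>x. ereal (f x)) s" and v: "v \<in> prox \<gamma> h (2 *\<^sub>R u - s)"
  shows "DR_envelope f h \<gamma> s = h v + ereal (prox_grad_model f \<gamma> u v)"
proof -
  have "(THE u. u \<in> prox \<gamma> (\<lambda>x. ereal (f x)) s) = u"
    using u prox_smooth_unique[OF assms(1-3)] by blast
  moreover have "2 *\<^sub>R u - s = u - \<gamma> *\<^sub>R grad f u"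
    unfolding prox_smooth_eq[OF assms(1,2) u, symmetric] by (simp add: scaleR_2)
  ultimately show ?thesis
    unfolding DR_envelope_def Let_def prox_grad_model_def[symmetric]
    using prox_grad_model_le[of \<gamma> v h u f] v \<open>0 < \<gamma>\<close>
    by (intro antisym INF_lower2[of v] INF_greatest) auto
qed

lemma prox_grad_model_ge:
  assumes "L_smooth L f" "0 < \<gamma>" "\<gamma> * L < 1"
  shows "f v \<le> prox_grad_model f \<gamma> u v"
proof -
  have "f v - f u - inner (grad f u) (v - u) \<le> L / 2 * (norm (v - u))\<^sup>2"
    using bregman_le_L_smooth[OF assms(1), of v u] by (simp add: bregman_def)
  also have "L \<le> 1 / \<gamma>" using assms(2,3) by (simp add: field_simps)
  then have "L / 2 * (norm (v - u))\<^sup>2 \<le> 1 / (2 * \<gamma>) * (norm (v - u))\<^sup>2"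
    by (intro mult_right_mono) auto
  finally show ?thesis by (simp add: prox_grad_model_def)
qed

text \<open>Both models are evaluated at the same point \<open>v\<close>. The relaxation step expresses \<open>v - u\<close> through
  the differences \<open>d\<close> of the points and \<open>e\<close> of the gradients, as \<open>- (d + \<gamma> e) / lam\<close>; the mixed terms
  then combine to \<open>(d - \<gamma> e) \<bullet> (d + \<gamma> e)\<close>, a difference of squares.\<close>

lemma prox_grad_model_step:
  fixes f :: "'a::real_inner \<Rightarrow> real"
  assumes "0 < \<gamma>" "0 < lam"
    and step: "u' + \<gamma> *\<^sub>R grad f u' = (u + \<gamma> *\<^sub>R grad f u) + lam *\<^sub>R (v - u)"
  shows "prox_grad_model f \<gamma> u v - prox_grad_model f \<gamma> u' v
    = bregman f (grad f) u u' + (2 - lam) / (2 * \<gamma> * lam) * (norm (u - u'))\<^sup>2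
      - \<gamma> / lam * (norm (grad f u - grad f u'))\<^sup>2"
proof -
  define d e where "d = u - u'" and "e = grad f u - grad f u'"
  define r where "r = v - u"
  have r: "lam *\<^sub>R r = - (d + \<gamma> *\<^sub>R e)" using step by (simp add: d_def e_def r_def algebra_simps)
  have rd: "inner x r = - (inner x d + \<gamma> * inner x e) / lam" for x
  proof -
    have "lam * inner x r = inner x (lam *\<^sub>R r)" by simp
    also have "\<dots> = - (inner x d + \<gamma> * inner x e)" unfolding r by (simp add: inner_diff_right)
    finally show ?thesis using \<open>0 < lam\<close> by (simp add: field_simps)
  qed
  have vu: "v - u = r" "v - u' = r + d" by (simp_all add: r_def d_def)
  have rd2: "(norm (r + d))\<^sup>2 = (norm r)\<^sup>2 + 2 * inner d r + (norm d)\<^sup>2"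
    unfolding power2_norm_eq_inner by (simp add: inner_add_left inner_add_right inner_commute[of r d])
  have "prox_grad_model f \<gamma> u v - prox_grad_model f \<gamma> u' v
     = f u + inner (grad f u) r - f u' - inner (grad f u') (r + d)
       - 1 / (2 * \<gamma>) * (2 * inner d r + (norm d)\<^sup>2)"
    unfolding prox_grad_model_def vu rd2 by (simp add: algebra_simps)
  also have "\<dots> = bregman f (grad f) u u'
      + (inner e r - 1 / \<gamma> * inner d r - (norm d)\<^sup>2 / (2 * \<gamma>))"
    using \<open>0 < \<gamma>\<close> by (simp add: bregman_def d_def[symmetric] e_def inner_diff_left inner_add_right field_simps)
  also have "inner e r - 1 / \<gamma> * inner d r - (norm d)\<^sup>2 / (2 * \<gamma>)
      = (2 - lam) / (2 * \<gamma> * lam) * (norm d)\<^sup>2 - \<gamma> / lam * (norm e)\<^sup>2"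
    unfolding rd power2_norm_eq_inner using \<open>0 < \<gamma>\<close> \<open>0 < lam\<close>
    by (simp add: inner_commute[of e d] field_simps power2_eq_square)
  finally show ?thesis by (simp add: d_def e_def algebra_simps)
qed

lemma DRS_residual_le:
  assumes "L_smooth L f" "0 < \<gamma>" "\<gamma> * L < 1" "0 < lam"
    and step: "u' + \<gamma> *\<^sub>R grad f u' = (u + \<gamma> *\<^sub>R grad f u) + lam *\<^sub>R (v - u)"
  shows "lam * norm (u - v) \<le> 2 * norm (u - u')"
proof -
  have "lam * norm (u - v) = norm (lam *\<^sub>R (v - u))"
    using \<open>0 < lam\<close> by (simp add: norm_minus_commute)
  also have "lam *\<^sub>R (v - u) = - ((u - u') + \<gamma> *\<^sub>R (grad f u - grad f u'))"
    using step by (simp add: algebra_simps)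
  also have "norm \<dots> \<le> norm (u - u') + norm (\<gamma> *\<^sub>R (grad f u - grad f u'))"
    unfolding norm_minus_cancel by (rule norm_triangle_ineq)
  also have "norm (\<gamma> *\<^sub>R (grad f u - grad f u')) \<le> \<gamma> * (L * norm (u - u'))"
    using L_smooth_dist_grad[OF assms(1), of u u'] \<open>0 < \<gamma>\<close> by simp
  also have "\<dots> = (\<gamma> * L) * norm (u - u')" by simp
  also have "\<dots> \<le> 1 * norm (u - u')" using assms(3) by (intro mult_right_mono) auto
  finally show ?thesis by simp
qed

section \<open>Regular subgradients\<close>

text \<open>The difference quotient is at least \<open>- C \<parallel>w - x\<parallel>\<close>, which tends to \<open>0\<close>. All subgradients below are
  of this proximal kind.\<close>

lemma regular_subdiff_quadratic_minorant:
  fixes h :: "'a::{real_inner, perfect_space} \<Rightarrow> ereal"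
  assumes fin: "h x = ereal r"
    and minor: "\<And>w. ereal (r + inner v (w - x) - C * (norm (w - x))\<^sup>2) \<le> h w"
  shows "v \<in> regular_subdiff h x"
proof -
  let ?q = "\<lambda>w. (h w - h x - ereal (inner v (w - x))) / ereal (norm (w - x))"
  have "((\<lambda>w. - C * norm (w - x)) \<longlongrightarrow> - C * norm (x - x)) (at x)"
    by (intro tendsto_intros)
  then have "((\<lambda>w. ereal (- C * norm (w - x))) \<longlongrightarrow> 0) (at x)"
    by (simp add: zero_ereal_def)
  then have "Liminf (at x) (\<lambda>w. ereal (- C * norm (w - x))) = 0"
    by (intro lim_imp_Liminf) simp
  moreover have "Liminf (at x) (\<lambda>w. ereal (- C * norm (w - x))) \<le> Liminf (at x) ?q"
  proof (rule Liminf_mono)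
    show "\<forall>\<^sub>F w in at x. ereal (- C * norm (w - x)) \<le> ?q w"
      unfolding eventually_at_filter
    proof (rule always_eventually, intro allI impI)
      fix w assume "w \<noteq> x"
      then have pos: "0 < norm (w - x)" by simp
      show "ereal (- C * norm (w - x)) \<le> ?q w"
      proof (cases "h w")
        case (real t)
        then have "- C * (norm (w - x))\<^sup>2 \<le> t - r - inner v (w - x)"
          using minor[of w] by simp
        then have "- C * norm (w - x) \<le> (t - r - inner v (w - x)) / norm (w - x)"
          using pos by (simp add: field_simps power2_eq_square)
        then show ?thesis using real fin pos by simp
      next
        case PInf
        then show ?thesis using fin pos by simp
      next
        case MInf
        then show ?thesis using minor[of w] by simp
      qed
    qed
  qed
  ultimately show ?thesis using fin by (simp add: regular_subdiff_def)
qed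

text \<open>Optimality of \<open>v\<close> in the proximal problem yields a quadratic minorant of \<open>h\<close> at \<open>v\<close> with slope
  \<open>(u - \<gamma> \<nabla>f(u) - v) / \<gamma>\<close>, and hypoconvexity yields one of \<open>f\<close> with slope \<open>\<nabla>f(v)\<close>.\<close>

lemma DRS_subgradient:
  fixes f :: "'a::{real_inner, perfect_space} \<Rightarrow> real"
  assumes f: "L_smooth L f" "hypoconvex \<sigma> f" and "proper h" "0 < \<gamma>"
    and v: "v \<in> prox \<gamma> h (u - \<gamma> *\<^sub>R grad f u)"
  shows "(1 / \<gamma>) *\<^sub>R ((u - \<gamma> *\<^sub>R grad f u) - (v - \<gamma> *\<^sub>R grad f v))
    \<in> regular_subdiff (\<lambda>x. ereal (f x) + h x) v"
proof -
  define y where "y = (1 / \<gamma>) *\<^sub>R ((u - \<gamma> *\<^sub>R grad f u) - (v - \<gamma> *\<^sub>R grad f v))"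
  define x where "x = u - \<gamma> *\<^sub>R grad f u"
  obtain b where b: "h v = ereal b" using prox_finite[OF \<open>proper h\<close> v] .
  have y: "y = (1 / \<gamma>) *\<^sub>R (x - v) + grad f v"
    using \<open>0 < \<gamma>\<close> by (simp add: y_def x_def algebra_simps)
  have "y \<in> regular_subdiff (\<lambda>x. ereal (f x) + h x) v"
  proof (rule regular_subdiff_quadratic_minorant[where r = "f v + b"])
    show "ereal (f v) + h v = ereal (f v + b)" by (simp add: b)
    fix w
    show "ereal (f v + b + inner y (w - v) - (1 / (2 * \<gamma>) - \<sigma> / 2) * (norm (w - v))\<^sup>2)
        \<le> ereal (f w) + h w"
    proof (cases "h w")
      case (real t)
      have "b + 1 / (2 * \<gamma>) * (norm (v - x))\<^sup>2 \<le> t + 1 / (2 * \<gamma>) * (norm (w - x))\<^sup>2"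
        using prox_le[OF v, of w] by (simp add: b real x_def)
      moreover have "(norm (w - x))\<^sup>2 = (norm (w - v))\<^sup>2 - 2 * inner (x - v) (w - v) + (norm (v - x))\<^sup>2"
        unfolding power2_norm_eq_inner
        by (simp add: inner_diff_left inner_diff_right inner_commute)
      ultimately have "b + 1 / \<gamma> * inner (x - v) (w - v) - 1 / (2 * \<gamma>) * (norm (w - v))\<^sup>2 \<le> t"
        using \<open>0 < \<gamma>\<close> by (simp add: field_simps)
      moreover have "\<sigma> / 2 * (norm (w - v))\<^sup>2 \<le> f w - f v - inner (grad f v) (w - v)"
        using bregman_ge_hypoconvex[OF f, of w v] by (simp add: bregman_def)
      ultimately show ?thesis
        by (simp add: real y inner_add_left left_diff_distrib)
    next
      case PInf
      then show ?thesis by simp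
    next
      case MInf
      then show ?thesis using \<open>proper h\<close> by (simp add: proper_def)
    qed
  qed
  then show ?thesis unfolding y_def .
qed

section \<open>Rate of square summable sequences\<close>

text \<open>The square of the minimum up to \<open>k\<close>, multiplied by \<open>k/2\<close>, is at most a sum over a window
  \<open>[N, k)\<close> with \<open>N < k/2\<close>, and such tails of a convergent series are arbitrarily small.\<close>

lemma summable_square_MIN_smallo:
  fixes a :: "nat \<Rightarrow> real"
  assumes nonneg: "\<And>k. 0 \<le> a k" and "summable (\<lambda>k. (a k)\<^sup>2)"
  shows "(\<lambda>k. MIN i\<in>{..k}. a i) \<in> o(\<lambda>k. 1 / sqrt (real k))"
proof (rule landau_o.smallI)
  fix c :: real assume "0 < c"
  then have "0 < c\<^sup>2 / 2" by simp
  with \<open>summable (\<lambda>k. (a k)\<^sup>2)\<close> obtain N where N: "\<And>m n. N \<le> m \<Longrightarrow> norm (\<Sum>i=m..<n. (a i)\<^sup>2) < c\<^sup>2 / 2"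
    unfolding summable_Cauchy by metis
  have "\<bar>MIN i\<in>{..k}. a i\<bar> \<le> c * \<bar>1 / sqrt (real k)\<bar>" if k: "2 * N + 1 \<le> k" for k
  proof -
    define m where "m = (MIN i\<in>{..k}. a i)"
    have "m \<in> a ` {..k}" unfolding m_def by (intro Min_in) auto
    then have "0 \<le> m" using nonneg by auto
    have "m \<le> a i" if "i \<le> k" for i unfolding m_def using that by (intro Min_le) auto
    then have "(\<Sum>i=N..<k. m\<^sup>2) \<le> (\<Sum>i=N..<k. (a i)\<^sup>2)"
      using \<open>0 \<le> m\<close> by (intro sum_mono power_mono) auto
    also have "\<dots> < c\<^sup>2 / 2" using N[of N k] by simp
    finally have "real (k - N) * m\<^sup>2 < c\<^sup>2 / 2" by simp
    moreover have "real k / 2 * m\<^sup>2 \<le> real (k - N) * m\<^sup>2"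
      using k by (intro mult_right_mono) (auto simp: of_nat_diff)
    ultimately have "real k * m\<^sup>2 \<le> c\<^sup>2" by simp
    then have "(sqrt (real k) * m)\<^sup>2 \<le> c\<^sup>2" by (simp add: power_mult_distrib)
    then have "sqrt (real k) * m \<le> c"
      by (rule power2_le_imp_le) (use \<open>0 < c\<close> in simp)
    then show ?thesis using k \<open>0 \<le> m\<close> unfolding m_def[symmetric] by (simp add: field_simps)
  qed
  then show "\<forall>\<^sub>F k in sequentially. norm (MIN i\<in>{..k}. a i) \<le> c * norm (1 / sqrt (real k))"
    unfolding eventually_sequentially real_norm_def by blast
qed

section \<open>Admissible stepsizes and sufficient decrease\<close>

text \<open>The decrease in terms of \<open>u - u'\<close> is converted into one in terms of the residual \<open>u - v\<close>. Under the
  first range condition \<open>\<sigma>\<close> is replaced by the weaker modulus \<open>min \<sigma> 0\<close>: the range involves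
  only the negative part of \<open>\<sigma>\<close>, and the worst case is known for nonpositive moduli.\<close>

lemma DRS_sufficient_decrease:
  fixes f :: "'a::real_inner \<Rightarrow> real"
  assumes f: "L_smooth L f" "hypoconvex \<sigma> f" and "0 < L" "\<sigma> \<le> L"
    and "0 < \<gamma>" "0 < lam" "\<gamma> * L < 1"
    and range: "lam < 2 + 2 * \<gamma> * min \<sigma> 0 \<or>
      0 < \<sigma> \<and> 2 \<le> lam \<and> 2 * \<gamma>\<^sup>2 * \<sigma> * L - \<gamma> * \<sigma> * lam + lam - 2 < 0"
  obtains c where "0 < c"
    and "\<And>u u' v. u' + \<gamma> *\<^sub>R grad f u' = (u + \<gamma> *\<^sub>R grad f u) + lam *\<^sub>R (v - u)
      \<Longrightarrow> c * (norm (u - v))\<^sup>2 \<le> prox_grad_model f \<gamma> u v - prox_grad_model f \<gamma> u' v"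
proof -
  have "\<exists>c \<tau>. 0 < c \<and> \<tau> \<le> \<sigma> \<and> (\<forall>(z::'a) d D. (norm z)\<^sup>2 \<le> (L - \<tau>) * inner z d \<longrightarrow>
      \<tau> / 2 * (norm d)\<^sup>2 + (norm z)\<^sup>2 / (2 * (L - \<tau>)) \<le> D \<longrightarrow>
      c * (norm d)\<^sup>2
        \<le> D + (2 - lam) / (2 * \<gamma> * lam) * (norm d)\<^sup>2 - \<gamma> / lam * (norm (z + \<tau> *\<^sub>R d))\<^sup>2)"
    using range
  proof
    assume "lam < 2 + 2 * \<gamma> * min \<sigma> 0"
    with assms obtain c where c: "0 < c" "\<And>(z::'a) d D. (norm z)\<^sup>2 \<le> (L - min \<sigma> 0) * inner z d \<Longrightarrow>
      min \<sigma> 0 / 2 * (norm d)\<^sup>2 + (norm z)\<^sup>2 / (2 * (L - min \<sigma> 0)) \<le> D \<Longrightarrow>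
      c * (norm d)\<^sup>2
        \<le> D + (2 - lam) / (2 * \<gamma> * lam) * (norm d)\<^sup>2 - \<gamma> / lam * (norm (z + min \<sigma> 0 *\<^sub>R d))\<^sup>2"
      using decrease_constant_nonpos_modulus[of L "min \<sigma> 0" \<gamma> lam, where 'a='a] by auto
    show ?thesis
      by (rule exI[of _ c], rule exI[of _ "min \<sigma> 0"]) (use c in simp)
  next
    assume "0 < \<sigma> \<and> 2 \<le> lam \<and> 2 * \<gamma>\<^sup>2 * \<sigma> * L - \<gamma> * \<sigma> * lam + lam - 2 < 0"
    with assms obtain c where c: "0 < c" "\<And>(z::'a) d D. (norm z)\<^sup>2 \<le> (L - \<sigma>) * inner z d \<Longrightarrow>
      \<sigma> / 2 * (norm d)\<^sup>2 + (norm z)\<^sup>2 / (2 * (L - \<sigma>)) \<le> D \<Longrightarrow>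
      c * (norm d)\<^sup>2
        \<le> D + (2 - lam) / (2 * \<gamma> * lam) * (norm d)\<^sup>2 - \<gamma> / lam * (norm (z + \<sigma> *\<^sub>R d))\<^sup>2"
      using decrease_constant_pos_modulus[of \<sigma> L \<gamma> lam, where 'a='a] by auto
    show ?thesis
      by (rule exI[of _ c], rule exI[of _ \<sigma>]) (use c in simp)
  qed
  then obtain c \<tau> where "0 < c" "\<tau> \<le> \<sigma>"
    and c: "\<And>(z::'a) d D. (norm z)\<^sup>2 \<le> (L - \<tau>) * inner z d \<Longrightarrow>
      \<tau> / 2 * (norm d)\<^sup>2 + (norm z)\<^sup>2 / (2 * (L - \<tau>)) \<le> D \<Longrightarrow>
      c * (norm d)\<^sup>2
        \<le> D + (2 - lam) / (2 * \<gamma> * lam) * (norm d)\<^sup>2 - \<gamma> / lam * (norm (z + \<tau> *\<^sub>R d))\<^sup>2"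
    by metis
  have \<tau>: "hypoconvex \<tau> f" "\<tau> \<le> L" using hypoconvex_mono[OF f(2) \<open>\<tau> \<le> \<sigma>\<close>] \<open>\<tau> \<le> \<sigma>\<close> \<open>\<sigma> \<le> L\<close> by auto
  show ?thesis
  proof (rule that)
    show "0 < c * (lam / 2)\<^sup>2" using \<open>0 < c\<close> \<open>0 < lam\<close> by simp
    fix u u' v :: 'a
    assume step: "u' + \<gamma> *\<^sub>R grad f u' = (u + \<gamma> *\<^sub>R grad f u) + lam *\<^sub>R (v - u)"
    have "lam / 2 * norm (u - v) \<le> norm (u - u')"
      using DRS_residual_le[OF f(1) \<open>0 < \<gamma>\<close> \<open>\<gamma> * L < 1\<close> \<open>0 < lam\<close> step] by simp
    then have "(lam / 2 * norm (u - v))\<^sup>2 \<le> (norm (u - u'))\<^sup>2"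
      using \<open>0 < lam\<close> by (intro power_mono) auto
    then have "c * ((lam / 2)\<^sup>2 * (norm (u - v))\<^sup>2) \<le> c * (norm (u - u'))\<^sup>2"
      unfolding power_mult_distrib using \<open>0 < c\<close> by (intro mult_left_mono) auto
    also have "\<dots> \<le> prox_grad_model f \<gamma> u v - prox_grad_model f \<gamma> u' v"
      unfolding prox_grad_model_step[OF \<open>0 < \<gamma>\<close> \<open>0 < lam\<close> step]
      using c[OF hypoconvex_bregman_cocoercive(2,1)[OF f(1) \<tau>, of u u']] by simp
    finally show "c * (lam / 2)\<^sup>2 * (norm (u - v))\<^sup>2
        \<le> prox_grad_model f \<gamma> u v - prox_grad_model f \<gamma> u' v" by simp
  qed
qed

text \<open>If \<open>\<sigma> \<ge> 0\<close> then the first entry of the minimum is \<open>(2 - lam) / 0 = \<infinity>\<close>, and the second conclusion is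
  \<open>lam < 2\<close>.\<close>

lemma stepsize_range_underrelaxed:
  assumes "0 < L" "0 < \<gamma>" "lam < 2"
    and "ereal \<gamma> < min (ereal (2 - lam) / ereal (2 * neg_part \<sigma>)) (ereal (1 / L))"
  shows "\<gamma> * L < 1" and "lam < 2 + 2 * \<gamma> * min \<sigma> 0"
proof -
  show "\<gamma> * L < 1" using assms(1,4) by (simp add: field_simps)
  show "lam < 2 + 2 * \<gamma> * min \<sigma> 0"
  proof (cases "\<sigma> < 0")
    case True
    then have "\<gamma> < (2 - lam) / (2 * - \<sigma>)" using assms(4) by (simp add: neg_part_def)
    then show ?thesis using True by (simp add: field_simps)
  next
    case False
    then show ?thesis using assms(3) by simp
  qed
qed

text \<open>The interval for \<open>\<gamma>\<close> lies between the roots of a quadratic polynomial, so it says that this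
  polynomial is negative at \<open>\<gamma>\<close>; being nonempty, it forces a positive discriminant. Its right end is at most
  \<open>1/L\<close> because \<open>\<delta> \<le> p (4 - lam)\<close>, where \<open>lam < 4\<close> by the upper bound on \<open>lam\<close>.\<close>

lemma stepsize_range_overrelaxed:
  assumes "0 < L" "0 < \<sigma>" "\<sigma> \<le> L" "2 \<le> lam"
    and p: "p = \<sigma> / L" and \<delta>: "\<delta> = sqrt ((p * lam)\<^sup>2 - 8 * p * (lam - 2))"
    and lam: "lam < 4 / (1 + sqrt (1 - p))"
    and \<gamma>: "(p * lam - \<delta>) / (4 * \<sigma>) < \<gamma>" "\<gamma> < (p * lam + \<delta>) / (4 * \<sigma>)"
  shows "\<gamma> * L < 1" and "2 * \<gamma>\<^sup>2 * \<sigma> * L - \<gamma> * \<sigma> * lam + lam - 2 < 0"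
proof -
  have "0 < p" "p \<le> 1" using assms(1-3) by (auto simp: p)
  have \<sigma>: "\<sigma> = p * L" using assms(1) by (simp add: p)
  have lo: "p * lam - \<delta> < 4 * \<sigma> * \<gamma>" and hi: "4 * \<sigma> * \<gamma> < p * lam + \<delta>"
    using \<gamma> \<open>0 < \<sigma>\<close> by (simp_all add: field_simps)
  then have "0 < \<delta>" by simp
  then have \<delta>2: "\<delta>\<^sup>2 = (p * lam)\<^sup>2 - 8 * p * (lam - 2)" by (simp add: \<delta>)
  have "4 / (1 + sqrt (1 - p)) \<le> 4 / 1" using \<open>p \<le> 1\<close>
    by (intro divide_left_mono mult_pos_pos add_pos_nonneg) auto
  then have "lam < 4" using lam by simp
  have "\<bar>4 * \<sigma> * \<gamma> - p * lam\<bar>\<^sup>2 < \<delta>\<^sup>2" using lo hi by (intro power_strict_mono) auto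
  then have "8 * p * (2 * \<gamma>\<^sup>2 * \<sigma> * L - \<gamma> * \<sigma> * lam + lam - 2) < 0"
    unfolding \<delta>2 \<sigma> by (simp add: power2_eq_square algebra_simps)
  then show "2 * \<gamma>\<^sup>2 * \<sigma> * L - \<gamma> * \<sigma> * lam + lam - 2 < 0"
    using \<open>0 < p\<close> by (simp add: mult_less_0_iff)
  have "0 \<le> 8 * p * (1 - p) * (lam - 2)"
    using \<open>0 < p\<close> \<open>p \<le> 1\<close> \<open>2 \<le> lam\<close> by (intro mult_nonneg_nonneg) auto
  then have "\<delta>\<^sup>2 \<le> (p * (4 - lam))\<^sup>2"
    unfolding \<delta>2 by (simp add: power2_eq_square algebra_simps)
  then have "\<delta> \<le> p * (4 - lam)"
    by (rule power2_le_imp_le) (use \<open>0 < p\<close> \<open>lam < 4\<close> in simp)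
  with hi have "4 * \<sigma> * \<gamma> < 4 * p" by (simp add: algebra_simps)
  then show "\<gamma> * L < 1" using \<open>0 < p\<close> unfolding \<sigma> by (simp add: mult.commute)
qed

section \<open>Convergence of the iterates\<close>

lemma lsc_le_seq_limit:
  assumes "lsc h" "y \<longlonglongrightarrow> x" "(\<lambda>k. h (y k)) \<longlonglongrightarrow> c"
  shows "h x \<le> c"
proof (rule ccontr)
  assume "\<not> h x \<le> c"
  then obtain t where t: "c < t" "t < h x" using dense not_le by metis
  have "h x \<le> Liminf (at x) h" using assms(1) by (simp add: lsc_def)
  with t have "\<forall>\<^sub>F w in at x. t < h w" by (simp add: le_Liminf_iff)
  then have "\<forall>\<^sub>F w in nhds x. t < h w" using t by (simp add: eventually_nhds_conv_at)
  then have "\<forall>\<^sub>F k in sequentially. t < h (y k)"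
    using assms(2) by (auto simp: filterlim_iff)
  then have "t \<le> c"
    using assms(3) by (intro tendsto_lowerbound[of _ c sequentially]) (auto elim: eventually_mono)
  with t show False by simp
qed

text \<open>The convergence analysis depends on the relaxation parameter only through the decrease property
  \<open>model_decrease\<close>, so that both parameter ranges are treated at once.\<close>

locale DRS_descent =
  fixes f :: "'a::euclidean_space \<Rightarrow> real" and h :: "'a \<Rightarrow> ereal"
    and L \<sigma> \<gamma> lam c :: real and s u v :: "nat \<Rightarrow> 'a"
  assumes f: "L_smooth L f" "hypoconvex \<sigma> f" and h: "proper h" "lsc h"
    and argmin: "argmin (\<lambda>x. ereal (f x) + h x) \<noteq> {}"
    and \<gamma>: "0 < \<gamma>" "\<gamma> * L < 1" and \<sigma>: "\<sigma> \<le> L"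
    and DRS: "DRS f h \<gamma> lam s u v"
    and c: "0 < c"
    and model_decrease: "\<And>u u' v. u' + \<gamma> *\<^sub>R grad f u' = (u + \<gamma> *\<^sub>R grad f u) + lam *\<^sub>R (v - u)
      \<Longrightarrow> c * (norm (u - v))\<^sup>2 \<le> prox_grad_model f \<gamma> u v - prox_grad_model f \<gamma> u' v"
begin

text \<open>The envelope at \<open>s k\<close>, as a real number so that its decreases can be summed; \<open>h (v k)\<close> is finite.\<close>

definition E :: "nat \<Rightarrow> real" where
  "E k = real_of_ereal (h (v k)) + prox_grad_model f \<gamma> (u k) (v k)"

lemma u_prox: "u k \<in> prox \<gamma> (\<lambda>x. ereal (f x)) (s k)"
  and v_prox': "v k \<in> prox \<gamma> h (2 *\<^sub>R u k - s k)"
  and s_Suc: "s (Suc k) = s k + lam *\<^sub>R (v k - u k)"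
  using DRS by (auto simp: DRS_def)

lemma s_eq: "s k = u k + \<gamma> *\<^sub>R grad f (u k)"
  using prox_smooth_eq[OF f(1) \<gamma>(1) u_prox] by simp

lemma v_prox: "v k \<in> prox \<gamma> h (u k - \<gamma> *\<^sub>R grad f (u k))"
  using v_prox'[of k] by (simp add: s_eq scaleR_2)

lemma h_v: "h (v k) = ereal (real_of_ereal (h (v k)))"
  using prox_finite[OF h(1) v_prox[of k]] by (metis real_of_ereal.simps(1))

lemma envelope_eq: "DR_envelope f h \<gamma> (s k) = ereal (E k)"
  by (subst DR_envelope_eq[OF f(1) \<gamma> u_prox v_prox'], subst h_v) (simp add: E_def)

lemma E_le:
  assumes "h w = ereal t"
  shows "E k \<le> t + prox_grad_model f \<gamma> (u k) w"
  using prox_grad_model_le[OF \<gamma>(1) v_prox[of k], of w] by (subst (asm) h_v) (simp add: assms E_def)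

text \<open>The model at \<open>u (Suc k)\<close> is tested at the old point \<open>v k\<close>, where the terms \<open>h (v k)\<close> cancel.\<close>

lemma E_decrease: "c * (norm (u k - v k))\<^sup>2 \<le> E k - E (Suc k)"
  using model_decrease[of "u (Suc k)" "u k" "v k"] E_le[OF h_v[of k], of "Suc k"]
    s_Suc[of k] by (simp add: s_eq E_def)

lemma objective_le_E: "ereal (f (v k)) + h (v k) \<le> ereal (E k)"
  using prox_grad_model_ge[OF f(1) \<gamma>, of "v k" "u k"]
  by (subst h_v) (simp add: E_def)

lemma decseq_E: "decseq E"
proof (rule decseq_SucI)
  fix k
  have "0 \<le> c * (norm (u k - v k))\<^sup>2" using c by simp
  with E_decrease[of k] show "E (Suc k) \<le> E k" by linarith
qed

lemma E_bounded_below: obtains m where "\<And>k. m \<le> E k"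
proof -
  obtain x0 where "x0 \<in> argmin (\<lambda>x. ereal (f x) + h x)" using argmin by auto
  then have x0: "ereal (f x0) + h x0 \<le> ereal (f x) + h x" for x
    by (auto simp: argmin_def is_arg_min_def not_less)
  then have le: "ereal (f x0) + h x0 \<le> ereal (E k)" for k
    using objective_le_E order_trans by blast
  have "h x0 \<noteq> -\<infinity>" using h(1) by (simp add: proper_def)
  with le[of 0] obtain t where "h x0 = ereal t" by (cases "h x0") auto
  with le that[of "f x0 + t"] show ?thesis by simp
qed

definition E_lim :: real where "E_lim = lim E"

lemma E_tendsto: "E \<longlonglongrightarrow> E_lim"
proof -
  obtain m where "\<And>k. m \<le> E k" using E_bounded_below by blast
  then obtain l where "E \<longlonglongrightarrow> l" using decseq_convergent[OF decseq_E] by blast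
  then show ?thesis unfolding E_lim_def by (simp add: limI)
qed

lemma summable_residual: "summable (\<lambda>k. (norm (u k - v k))\<^sup>2)"
proof -
  have "summable (\<lambda>k. E k - E (Suc k))"
    using telescope_summable'[OF E_tendsto] .
  then have "summable (\<lambda>k. (E k - E (Suc k)) / c)" by (rule summable_divide)
  then show ?thesis
  proof (rule summable_comparison_test'[where N = 0])
    show "norm ((norm (u k - v k))\<^sup>2) \<le> (E k - E (Suc k)) / c" for k
      using E_decrease[of k] c by (simp add: field_simps)
  qed
qed

lemma residual_tendsto: "(\<lambda>k. u k - v k) \<longlonglongrightarrow> 0"
proof -
  have "(\<lambda>k. sqrt ((norm (u k - v k))\<^sup>2)) \<longlonglongrightarrow> sqrt 0"
    by (intro tendsto_real_sqrt summable_LIMSEQ_zero summable_residual)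
  then show ?thesis by (simp add: tendsto_norm_zero_iff)
qed

lemma residual_rate: "(\<lambda>k. MIN i\<in>{..k}. norm (u i - v i)) \<in> o(\<lambda>k. 1 / sqrt (real k))"
  by (intro summable_square_MIN_smallo summable_residual) simp

lemma cluster_points_eq: "cluster_points u = cluster_points v"
proof -
  have "(u \<circ> r) \<longlonglongrightarrow> x \<longleftrightarrow> (v \<circ> r) \<longlonglongrightarrow> x" if r: "strict_mono r" for r x
  proof -
    have "(\<lambda>k. u (r k) - v (r k)) \<longlonglongrightarrow> 0"
      using LIMSEQ_subseq_LIMSEQ[OF residual_tendsto r] by (simp add: o_def)
    then show ?thesis
      using Lim_transform2[of "\<lambda>k. u (r k)" x sequentially "\<lambda>k. v (r k)"]
        Lim_transform[of "\<lambda>k. v (r k)" x sequentially "\<lambda>k. u (r k)"]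
      unfolding o_def by argo
  qed
  then show ?thesis unfolding cluster_points_def by blast
qed

lemma isCont_grad: "isCont (grad f) x"
  using f(1) lipschitz_on_continuous_on[of L UNIV "grad f"]
  by (auto simp: L_smooth_def continuous_on_eq_continuous_at)

lemma isCont_f: "isCont f x"
  using L_smooth_GDERIV[OF f(1)] has_derivative_continuous unfolding gderiv_def by blast

lemma tendsto_model:
  assumes "y \<longlonglongrightarrow> x" "w \<longlonglongrightarrow> z"
  shows "(\<lambda>k. prox_grad_model f \<gamma> (y k) (w k)) \<longlonglongrightarrow> prox_grad_model f \<gamma> x z"
  unfolding prox_grad_model_def
  by (intro tendsto_intros assms isCont_tendsto_compose[OF isCont_f]
      isCont_tendsto_compose[OF isCont_grad])

text \<open>Every envelope value is a minimum over \<open>w\<close> of \<open>h\<close> plus the model at \<open>u k\<close>. For fixed \<open>w\<close> this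
  passes to the limit, as the model is continuous in its base point.\<close>

lemma cluster_point_model_min:
  assumes "x \<in> cluster_points u" "h w = ereal t"
  shows "E_lim \<le> t + prox_grad_model f \<gamma> x w"
proof -
  obtain r where r: "strict_mono r" "(u \<circ> r) \<longlonglongrightarrow> x" using assms(1) by (auto simp: cluster_points_def)
  have "(\<lambda>k. t + prox_grad_model f \<gamma> ((u \<circ> r) k) w) \<longlonglongrightarrow> t + prox_grad_model f \<gamma> x w"
    by (intro tendsto_add tendsto_model r(2) tendsto_const)
  then show ?thesis
    by (rule LIMSEQ_le[OF LIMSEQ_subseq_LIMSEQ[OF E_tendsto r(1)]]) (use E_le[OF assms(2)] in auto)
qed

text \<open>Lower semicontinuity gives \<open>h x \<le> E_lim - f x\<close>, as the values \<open>h (v k)\<close> converge along the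
  subsequence. The reverse inequality is the minimum property at \<open>w = x\<close>.\<close>

lemma cluster_point_value:
  assumes "x \<in> cluster_points u"
  shows "h x = ereal (E_lim - f x)"
proof -
  obtain r where r: "strict_mono r" "(u \<circ> r) \<longlonglongrightarrow> x" using assms by (auto simp: cluster_points_def)
  have "(\<lambda>k. u (r k) - v (r k)) \<longlonglongrightarrow> 0"
    using LIMSEQ_subseq_LIMSEQ[OF residual_tendsto r(1)] by (simp add: o_def)
  then have v: "(\<lambda>k. v (r k)) \<longlonglongrightarrow> x"
    using tendsto_diff[OF r(2), of "\<lambda>k. u (r k) - v (r k)" 0] by (simp add: o_def)
  have "(\<lambda>k. E (r k) - prox_grad_model f \<gamma> (u (r k)) (v (r k))) \<longlonglongrightarrow> E_lim - prox_grad_model f \<gamma> x x"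
    using LIMSEQ_subseq_LIMSEQ[OF E_tendsto r(1)] r(2) v
    by (intro tendsto_diff tendsto_model) (auto simp: o_def)
  then have "(\<lambda>k. real_of_ereal (h (v (r k)))) \<longlonglongrightarrow> E_lim - f x"
    by (simp add: E_def prox_grad_model_def[of f \<gamma> x x])
  then have "(\<lambda>k. h (v (r k))) \<longlonglongrightarrow> ereal (E_lim - f x)"
    by (subst h_v) simp
  from lsc_le_seq_limit[OF h(2) v this] have le: "h x \<le> ereal (E_lim - f x)" .
  moreover have "h x \<noteq> -\<infinity>" using h(1) by (simp add: proper_def)
  ultimately obtain t where t: "h x = ereal t" by (cases "h x") auto
  with le cluster_point_model_min[OF assms t] show ?thesis by (simp add: prox_grad_model_def)
qed

text \<open>By the minimum property at \<open>x\<close>, \<open>h\<close> lies above a paraboloid with slope \<open>- \<nabla>f(x)\<close>, and this slope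
  cancels that of \<open>f\<close>.\<close>

lemma cluster_point_stationary:
  assumes "x \<in> cluster_points u"
  shows "stationary (\<lambda>x. ereal (f x) + h x) x"
  unfolding stationary_def
proof (rule regular_subdiff_quadratic_minorant[where r = E_lim])
  show "ereal (f x) + h x = ereal E_lim" by (simp add: cluster_point_value[OF assms])
  fix w
  show "ereal (E_lim + inner 0 (w - x) - (1 / (2 * \<gamma>) - \<sigma> / 2) * (norm (w - x))\<^sup>2) \<le> ereal (f w) + h w"
  proof (cases "h w")
    case (real t)
    have "\<sigma> / 2 * (norm (w - x))\<^sup>2 \<le> f w - f x - inner (grad f x) (w - x)"
      using bregman_ge_hypoconvex[OF f, of w x] by (simp add: bregman_def)
    with cluster_point_model_min[OF assms real] real show ?thesis
      by (simp add: prox_grad_model_def left_diff_distrib)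
  next
    case PInf
    then show ?thesis by simp
  next
    case MInf
    then show ?thesis using h(1) by (simp add: proper_def)
  qed
qed

lemma subdiff_dist:
  "edist_set 0 (regular_subdiff (\<lambda>x. ereal (f x) + h x) (v k))
    \<le> ereal ((1 - \<gamma> * \<sigma>) / \<gamma> * norm (u k - v k))"
  unfolding edist_set_def
proof (rule INF_lower2[OF DRS_subgradient[OF f h(1) \<gamma>(1) v_prox[of k]]])
  define y where "y = u k - \<gamma> *\<^sub>R grad f (u k) - (v k - \<gamma> *\<^sub>R grad f (v k))"
  have "norm y \<le> (1 - \<gamma> * \<sigma>) * norm (u k - v k)"
    unfolding y_def by (rule gradient_step_lipschitz[OF f \<sigma> \<gamma>])
  then have "norm y / \<gamma> \<le> (1 - \<gamma> * \<sigma>) * norm (u k - v k) / \<gamma>"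
    using \<gamma>(1) by (intro divide_right_mono) auto
  then show "ereal (dist 0 ((1 / \<gamma>) *\<^sub>R (u k - \<gamma> *\<^sub>R grad f (u k) - (v k - \<gamma> *\<^sub>R grad f (v k)))))
    \<le> ereal ((1 - \<gamma> * \<sigma>) / \<gamma> * norm (u k - v k))"
    unfolding y_def[symmetric] using \<gamma>(1) by simp
qed

text \<open>The values of the objective at \<open>v k\<close> are bounded by the initial value of the envelope, and \<open>u k\<close> and
  \<open>s k\<close> are controlled by \<open>v k\<close>, the vanishing residual and the Lipschitz gradient.\<close>

lemma bounded_iterates:
  assumes "bounded_level_sets (\<lambda>x. ereal (f x) + h x)"
  shows "bounded (range (\<lambda>k. (s k, u k, v k)))"
proof -
  have "ereal (f (v k)) + h (v k) \<le> ereal (E 0)" for k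
    by (rule order_trans[OF objective_le_E]) (simp add: decseqD[OF decseq_E])
  then have "range v \<subseteq> {x. ereal (f x) + h x \<le> ereal (E 0)}"
    by (intro image_subsetI CollectI)
  moreover have "bounded {x. ereal (f x) + h x \<le> ereal (E 0)}"
    using assms by (simp add: bounded_level_sets_def)
  ultimately have v: "bounded (range v)" by (rule bounded_subset[rotated])
  have "bounded (range (\<lambda>k. u k - v k))"
    using residual_tendsto by (intro convergent_imp_bounded)
  from bounded_plus_comp[OF v this] have u: "bounded (range u)" by simp
  have "L-lipschitz_on (range u) (grad f)"
    using f(1) lipschitz_on_subset[of L UNIV "grad f" "range u"] by (simp add: L_smooth_def)
  then have "uniformly_continuous_on (range u) (grad f)"
    by (rule lipschitz_on_uniformly_continuous)
  then have "bounded (grad f ` range u)"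
    using u by (rule bounded_uniformly_continuous_image)
  then have "bounded (range (\<lambda>k. \<gamma> *\<^sub>R grad f (u k)))"
    using bounded_scaleR_comp[of "\<lambda>k. grad f (u k)" UNIV] by (simp add: image_image)
  from bounded_plus_comp[OF u this] have s: "bounded (range s)" by (simp add: s_eq[symmetric])
  show ?thesis
    by (rule bounded_subset[OF bounded_Times[OF s bounded_Times[OF u v]]]) auto
qed

end

theorem theorem4p3:
  fixes \<phi>1 :: "real ^ 'p \<Rightarrow> real"
    and \<phi>2 \<phi> :: "real ^ 'p \<Rightarrow> ereal"
    and L \<sigma> p1 \<delta> \<gamma> lam :: real
    and s u v :: "nat \<Rightarrow> real ^ 'p"
  assumes "L > 0" and "- L \<le> \<sigma>" and "\<sigma> \<le> L"
    and "L_smooth L \<phi>1" and "hypoconvex \<sigma> \<phi>1"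
    and "proper \<phi>2" and "lsc \<phi>2"
    and phi: "\<phi> = (\<lambda>x. ereal (\<phi>1 x) + \<phi>2 x)"
    and "argmin \<phi> \<noteq> {}"
    and p1: "p1 = \<sigma> / L"
    and delta: "\<delta> = sqrt ((p1 * lam)\<^sup>2 - 8 * p1 * (lam - 2))"
    and "\<gamma> > 0" and "lam > 0"
    and "(lam < 2 \<and>
            ereal \<gamma> < min (ereal (2 - lam) / ereal (2 * neg_part \<sigma>)) (ereal (1 / L)))
         \<or> (\<sigma> > 0 \<and> 2 \<le> lam \<and> lam < 4 / (1 + sqrt (1 - p1)) \<and>
            (p1 * lam - \<delta>) / (4 * \<sigma>) < \<gamma> \<and> \<gamma> < (p1 * lam + \<delta>) / (4 * \<sigma>))"
    and "DRS \<phi>1 \<phi>2 \<gamma> lam s u v"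
  shows
    "((\<lambda>k. u k - v k) \<longlonglongrightarrow> 0 \<and>
      (\<lambda>k. MIN i\<in>{..k}. norm (u i - v i)) \<in> o(\<lambda>k. 1 / sqrt (real k)))
     \<and>
     (cluster_points u = cluster_points v \<and>
      (\<forall>x\<in>cluster_points u. stationary \<phi> x) \<and>
      (\<exists>l::real. (\<lambda>k. DR_envelope \<phi>1 \<phi>2 \<gamma> (s k)) \<longlonglongrightarrow> ereal l \<and>
                 (\<forall>x\<in>cluster_points u. \<phi> x = ereal l)) \<and>
      (\<forall>k. edist_set 0 (regular_subdiff \<phi> (v k))
             \<le> ereal ((1 - \<gamma> * \<sigma>) / \<gamma> * norm (u k - v k))))
     \<and>
     (bounded_level_sets \<phi> \<longrightarrow> bounded (range (\<lambda>k. (s k, u k, v k))))"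
proof -
  have range: "\<gamma> * L < 1 \<and> (lam < 2 + 2 * \<gamma> * min \<sigma> 0 \<or>
      0 < \<sigma> \<and> 2 \<le> lam \<and> 2 * \<gamma>\<^sup>2 * \<sigma> * L - \<gamma> * \<sigma> * lam + lam - 2 < 0)"
    using assms(14)
  proof (elim disjE conjE)
    assume "lam < 2" "ereal \<gamma> < min (ereal (2 - lam) / ereal (2 * neg_part \<sigma>)) (ereal (1 / L))"
    from stepsize_range_underrelaxed[OF \<open>L > 0\<close> \<open>\<gamma> > 0\<close> this] show ?thesis by blast
  next
    assume a: "\<sigma> > 0" "2 \<le> lam" and b: "lam < 4 / (1 + sqrt (1 - p1))"
      "(p1 * lam - \<delta>) / (4 * \<sigma>) < \<gamma>" "\<gamma> < (p1 * lam + \<delta>) / (4 * \<sigma>)"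
    from stepsize_range_overrelaxed[OF \<open>L > 0\<close> a(1) \<open>\<sigma> \<le> L\<close> a(2) p1 delta b] a
    show ?thesis by blast
  qed
  obtain c where "0 < c"
    and "\<And>u u' v. u' + \<gamma> *\<^sub>R grad \<phi>1 u' = (u + \<gamma> *\<^sub>R grad \<phi>1 u) + lam *\<^sub>R (v - u)
      \<Longrightarrow> c * (norm (u - v))\<^sup>2 \<le> prox_grad_model \<phi>1 \<gamma> u v - prox_grad_model \<phi>1 \<gamma> u' v"
    using DRS_sufficient_decrease[OF \<open>L_smooth L \<phi>1\<close> \<open>hypoconvex \<sigma> \<phi>1\<close> \<open>L > 0\<close> \<open>\<sigma> \<le> L\<close>
        \<open>\<gamma> > 0\<close> \<open>lam > 0\<close> conjunct1[OF range] conjunct2[OF range]] by metis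
  then interpret DRS_descent \<phi>1 \<phi>2 L \<sigma> \<gamma> lam c s u v
    using assms(3-7,12,15) conjunct1[OF range] \<open>argmin \<phi> \<noteq> {}\<close>[unfolded phi]
    by unfold_locales
  have "(\<lambda>k. DR_envelope \<phi>1 \<phi>2 \<gamma> (s k)) \<longlonglongrightarrow> ereal E_lim"
    using E_tendsto by (simp add: envelope_eq)
  then show ?thesis
    unfolding phi
    by (intro conjI ballI allI impI exI[of _ E_lim] residual_tendsto residual_rate
        cluster_points_eq cluster_point_stationary subdiff_dist bounded_iterates)
      (simp_all add: cluster_point_value)
qed

end
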